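(* Let $K$ be a totally disconnected (nondiscrete) local field with its normalized absolute value $|\cdot| : K \to [0,\infty)$, with Haar measure and Fourier (Plancherel) transform $f \mapsto \widehat{f}$, regarded as a unitary map $L^2(K) \to L^2(K)$ through a self-dual identification of $\widehat{K}$ with $K$. Then for all $f \in L^2(K)$, \[ \inf_{a,b \in K} \int_{K} |x-a|^2 |f(x)|^2 \, dx \int_{K} |\xi-b|^2 |\widehat{f}(\xi)|^2 \, d\xi \ \ge\ \alpha_1 \|f\|_2^4 , \] where \[ \alpha_1 = \max_{\delta \in (0,1/2)} (1-2\delta)^{4} (2\delta - \delta^2)^4 . \]
   Context: A totally disconnected local field is a locally compact, second countable, nondiscrete topological field that is not connected. Its absolute value $|\cdot|$ satisfies: $|x|=0$ iff $x=0$; $|xy|=|x||y|$; $|x+y| \le \max\{|x|,|y|\}$; and for every Borel set $A \subset K$ and $x \in K$ the Haar measure of $xA = \{xy : y \in A\}$ equals $|x|$ times the Haar measure of $A$. The set of values is $\{q^k : k \in \mathbb{Z}\} \cup \{0\}$ for a suitable prime power $q$. Haar measure $dx$ on the additive group $K$ is normalized so that $\{x \in K : |x| \le 1\}$ has measure $1$. Fix a character $\chi$ of the additive group $K$ that is trivial on $\{x \in K: |x| \le 1\}$ but not trivial on $\{x \in K: |x| \le q\}$. The map $x \mapsto \chi_x$, $\chi_x(y) = \chi(xy)$, is a topological isomorphism $K \to \widehat{K}$, used to identify $\widehat{K}$ with $K$; thus $\widehat{f}(\xi) = \int_K f(x) \overline{\chi(\xi x)} \, dx$ for $f \in L^1(K)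 \cap L^2(K)$, extended to $L^2(K)$, and with these normalizations $\|f\|_2 = \|\widehat{f}\|_2$. *)

theory Defs
  imports "HOL-Analysis.Analysis" "HOL-Computational_Algebra.Primes"
begin

class topological_field = field + topological_ab_group_add + topological_semigroup_mult + t2_space +
  assumes tendsto_inverse_nhds: "a \<noteq> 0 \<Longrightarrow> filterlim inverse (nhds (inverse a)) (nhds a)"

class td_local_field = topological_field + second_countable_topology +
  assumes locally_compact_field: "\<And>x. \<exists>U K. open U \<and> compact K \<and> x \<in> U \<and> U \<subseteq> K"
    and nondiscrete_field: "\<exists>A :: 'a set. \<not> open A"
    and not_connected_field: "\<not> connected (UNIV :: 'a set)"

definition haar_measure :: "'a::{topological_group_add} measure \<Rightarrow> bool" where
  "haar_measure \<mu> \<longleftrightarrow>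
     sets \<mu> = sets borel \<and>
     emeasure \<mu> UNIV \<noteq> 0 \<and>
     (\<forall>C. compact C \<longrightarrow> emeasure \<mu> C < \<infinity>) \<and>
     (\<forall>x. \<forall>A\<in>sets borel. emeasure \<mu> ((\<lambda>y. x + y) ` A) = emeasure \<mu> A)"

text \<open>
  The absolute value of the field, with its value group, normalized Haar measure and the character
  used for the self-duality. The assumption \<open>scaling\<close> determines the absolute value.
  The last clause of the absolute value, \<open>topology\<close>, says that it is an absolute value of the
  given topological field; this holds for every local field, so it restricts nothing.
\<close>

locale local_field_data =
  fixes absv :: "'a::td_local_field \<Rightarrow> real"
    and q :: nat
    and \<mu> :: "'a measure"
    and \<psi> :: "'a \<Rightarrow> complex"
  assumes absv_nonneg: "\<And>x. 0 \<le> absv x"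
    and absv_eq_0_iff: "\<And>x. absv x = 0 \<longleftrightarrow> x = 0"
    and absv_mult: "\<And>x y. absv (x * y) = absv x * absv y"
    and ultrametric: "\<And>x y. absv (x + y) \<le> max (absv x) (absv y)"
    and topology: "\<And>S. open S \<longleftrightarrow> (\<forall>x\<in>S. \<exists>e>0. \<forall>y. absv (y - x) < e \<longrightarrow> y \<in> S)"
    and prime_power: "\<exists>p k. prime (p::nat) \<and> k \<ge> 1 \<and> q = p ^ k"
    and value_group: "range absv = insert 0 (range (\<lambda>k::int. real q powi k))"
    and haar: "haar_measure \<mu>"
    and scaling: "\<And>x A. A \<in> sets borel \<Longrightarrow>
          emeasure \<mu> ((\<lambda>y. x * y) ` A) = ennreal (absv x) * emeasure \<mu> A"
    and normalized: "emeasure \<mu> {x. absv x \<le> 1} = 1"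
    and character_continuous: "continuous_on UNIV \<psi>"
    and character_norm: "\<And>x. norm (\<psi> x) = 1"
    and character_add: "\<And>x y. \<psi> (x + y) = \<psi> x * \<psi> y"
    and character_trivial: "\<And>x. absv x \<le> 1 \<Longrightarrow> \<psi> x = 1"
    and character_nontrivial: "\<exists>x. absv x \<le> real q \<and> \<psi> x \<noteq> 1"

definition square_integrable :: "'a measure \<Rightarrow> ('a \<Rightarrow> complex) \<Rightarrow> bool" where
  "square_integrable \<mu> f \<longleftrightarrow>
     f \<in> borel_measurable \<mu> \<and> integrable \<mu> (\<lambda>x. (norm (f x))\<^sup>2)"

definition l2_norm :: "'a measure \<Rightarrow> ('a \<Rightarrow> complex) \<Rightarrow> real" where
  "l2_norm \<mu> f = sqrt (\<integral>x. (norm (f x))\<^sup>2 \<partial>\<mu>)"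

definition l2_tendsto :: "'a measure \<Rightarrow> (nat \<Rightarrow> 'a \<Rightarrow> complex) \<Rightarrow> ('a \<Rightarrow> complex) \<Rightarrow> bool" where
  "l2_tendsto \<mu> h f \<longleftrightarrow>
     (\<lambda>n. \<integral>\<^sup>+x. ennreal ((norm (h n x - f x))\<^sup>2) \<partial>\<mu>) \<longlonglongrightarrow> 0"

definition fourier_integral ::
    "'a::times measure \<Rightarrow> ('a \<Rightarrow> complex) \<Rightarrow> ('a \<Rightarrow> complex) \<Rightarrow> 'a \<Rightarrow> complex" where
  "fourier_integral \<mu> \<psi> f \<xi> = (\<integral>x. f x * cnj (\<psi> (\<xi> * x)) \<partial>\<mu>)"

text \<open>
  The extension by continuity of the Fourier integral from \<open>L\<^sup>1 \<inter> L\<^sup>2\<close> to \<open>L\<^sup>2\<close>.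
  The limit is unique only almost everywhere; the choice picks a representative.
\<close>

definition plancherel_transform ::
    "'a::times measure \<Rightarrow> ('a \<Rightarrow> complex) \<Rightarrow> ('a \<Rightarrow> complex) \<Rightarrow> 'a \<Rightarrow> complex" where
  "plancherel_transform \<mu> \<psi> f = (SOME g. square_integrable \<mu> g \<and>
     (\<exists>h. (\<forall>n. integrable \<mu> (h n) \<and> square_integrable \<mu> (h n)) \<and>
          l2_tendsto \<mu> h f \<and>
          l2_tendsto \<mu> (\<lambda>n. fourier_integral \<mu> \<psi> (h n)) g))"

text \<open>\<open>Max\<close> is only meaningful for finite sets, hence the use of \<open>GREATEST\<close>.\<close>

definition alpha1 :: real where
  "alpha1 = (GREATEST y. \<exists>\<delta>\<in>{0<..<1/2}. y = (1 - 2 * \<delta>) ^ 4 * (2 * \<delta> - \<delta>\<^sup>2) ^ 4)"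

end

theory Submission
  imports Defs
begin

text \<open>
  For discs \<open>A\<close> and \<open>B\<close> with \<open>|A||B| = 1/q\<close>, the Fourier transform restricted to functions supported in \<open>A\<close>
  and observed on \<open>B\<close> has squared norm at most \<open>1/q \<le> 1/2\<close>. By Plancherel, \<open>f\<close> cannot be concentrated on \<open>A\<close>
  while its transform is concentrated on \<open>B\<close>. The radius of \<open>A\<close> is taken just large enough that, by
  Chebyshev, most of the mass of \<open>f\<close> lies in \<open>A\<close>; hence a fixed proportion of the mass of the transform
  lies outside \<open>B\<close>. The resulting product of second moments is at least \<open>\<parallel>f\<parallel>\<^sup>4 / 192\<close>, whereas
  \<open>alpha1 \<le> 1 / 256\<close>.

  Plancherel's theorem is the limit of an identity on discs: twice the mass of the transform on the disc of radius
  \<open>q^n\<close>, plus the average of \<open>|f(x) - f(y)|\<^sup>2\<close> over \<open>|x - y| \<le> q^(-n)\<close>, is twice the mass of \<open>f\<close>.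
\<close>

section \<open>Square-integrable functions\<close>

text \<open>The gap in the value group makes the product scale-free. If \<open>A\<close> has radius
  \<open>r\<close>, then \<open>B\<close> has radius \<open>1 / (q * r)\<close>, but every point
  outside \<open>B\<close> is at distance at least \<open>1 / r\<close> from its centre. The choice
  of \<open>r\<close> makes the moment of \<open>f\<close> at least \<open>r\<^sup>2 / 24\<close>
  times its mass, so \<open>r\<close> and \<open>q\<close> both cancel. Of the mass of the transform
  in \<open>B\<close>, at most 3/4 of the total is charged to the part of \<open>f\<close> in
  \<open>A\<close> and at most 1/8 to the rest; the remaining 1/8 lies outside \<open>B\<close>, and
  192 = 24 * 8.

  \<open>plancherel_transform\<close> is a choice, so nothing is known about it before a limit of
  Fourier integrals is shown to exist; this is why completeness and Plancherel are developed here.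
  The transform of an integrable function is at first only known to be bounded, so its square is
  integrated over a disc, where Fubini applies. The cutoff error is exactly the averaged difference
  term. It vanishes for the indicator of a disc once the averaging radius is at most that of the
  disc, and tends to 0 for all square-integrable functions by approximation.\<close>

definition energy :: "'b measure \<Rightarrow> 'b set \<Rightarrow> ('b \<Rightarrow> complex) \<Rightarrow> ennreal"
  where "energy M S h = (\<integral>\<^sup>+x\<in>S. ennreal ((norm (h x))\<^sup>2) \<partial>M)"

lemma ennreal_tendsto_0_le:
  fixes f g :: "nat \<Rightarrow> ennreal"
  assumes "g \<longlonglongrightarrow> 0" "\<And>n. f n \<le> g n"
  shows "f \<longlonglongrightarrow> 0"
proof (rule tendsto_sandwich[OF _ _ tendsto_const assms(1)])
  show "\<forall>\<^sub>F n in sequentially. f n \<le> g n"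
    by (rule always_eventually) (rule allI, rule assms(2))
qed (rule always_eventually, rule allI, rule zero_le)

lemma borel_measurable_cnj [measurable (raw)]:
  "f \<in> borel_measurable M \<Longrightarrow> (\<lambda>x. cnj (f x)) \<in> borel_measurable M"
  by (rule borel_measurable_continuous_on[of cnj]) (auto intro: continuous_intros)

text \<open>Young's inequality for the cross term: \<open>2 * norm a * norm b\<close> is at most
  \<open>t * (norm a)\<^sup>2 + (norm b)\<^sup>2 / t\<close>. The free weight \<open>t\<close>
  allows a coefficient close to 1 on one summand, at the price of a large one on the other.\<close>

lemma norm_add_power2_le:
  fixes a b :: "'b::real_normed_vector"
  assumes "0 < t"
  shows "(norm (a + b))\<^sup>2 \<le> (1 + t) * (norm a)\<^sup>2 + (1 + 1 / t) * (norm b)\<^sup>2"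
proof -
  have "(norm (a + b))\<^sup>2 \<le> (norm a + norm b)\<^sup>2"
    by (intro power_mono norm_triangle_ineq) simp
  also have "\<dots> \<le> (1 + t) * (norm a)\<^sup>2 + (1 + 1 / t) * (norm b)\<^sup>2"
  proof -
    have "0 \<le> (t * norm a - norm b)\<^sup>2 / t"
      using assms by simp
    then show ?thesis
      using assms by (simp add: power2_eq_square field_simps)
  qed
  finally show ?thesis .
qed

lemma energy_add_le:
  assumes [measurable]: "u \<in> borel_measurable M" "v \<in> borel_measurable M" "S \<in> sets M"
    and t: "0 < t"
  shows "energy M S (\<lambda>x. u x + v x) \<le> ennreal (1 + t) * energy M S u + ennreal (1 + 1 / t) * energy M S v"
proof -
  have "energy M S (\<lambda>x. u x + v x) \<le> (\<integral>\<^sup>+x. ennreal (1 + t) * (ennreal ((norm (u x))\<^sup>2) * indicator S x)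
      + ennreal (1 + 1 / t) * (ennreal ((norm (v x))\<^sup>2) * indicator S x) \<partial>M)"
    unfolding energy_def
  proof (rule nn_integral_mono)
    fix x
    have "ennreal ((norm (u x + v x))\<^sup>2)
        \<le> ennreal (1 + t) * ennreal ((norm (u x))\<^sup>2) + ennreal (1 + 1 / t) * ennreal ((norm (v x))\<^sup>2)"
      using norm_add_power2_le[OF t, of "u x" "v x"] t
      by (simp add: ennreal_mult[symmetric] ennreal_plus[symmetric] ennreal_leI del: ennreal_plus)
    then show "ennreal ((norm (u x + v x))\<^sup>2) * indicator S x \<le> ennreal (1 + t) * (ennreal ((norm (u x))\<^sup>2) * indicator S x)
      + ennreal (1 + 1 / t) * (ennreal ((norm (v x))\<^sup>2) * indicator S x)"
      by (simp split: split_indicator)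
  qed
  then show ?thesis
    by (simp add: energy_def nn_integral_add nn_integral_cmult)
qed

lemma energy_mono_set: "S \<subseteq> T \<Longrightarrow> energy M S h \<le> energy M T h"
  unfolding energy_def by (intro nn_integral_mono) (auto split: split_indicator)

lemma energy_split:
  assumes [measurable]: "h \<in> borel_measurable M" "S \<in> sets M"
  shows "energy M UNIV h = energy M S h + energy M (- S) h"
proof -
  have "energy M UNIV h = (\<integral>\<^sup>+x. ennreal ((norm (h x))\<^sup>2) * indicator S x
      + ennreal ((norm (h x))\<^sup>2) * indicator (space M - S) x \<partial>M)"
    unfolding energy_def by (intro nn_integral_cong) (auto split: split_indicator)
  also have "\<dots> = energy M S h + (\<integral>\<^sup>+x. ennreal ((norm (h x))\<^sup>2) * indicator (space M - S) x \<partial>M)"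
    unfolding energy_def by (intro nn_integral_add) auto
  also have "(\<integral>\<^sup>+x. ennreal ((norm (h x))\<^sup>2) * indicator (space M - S) x \<partial>M) = energy M (- S) h"
    unfolding energy_def by (intro nn_integral_cong) (auto split: split_indicator)
  finally show ?thesis .
qed

lemma square_integrable_iff:
  "square_integrable M h \<longleftrightarrow> h \<in> borel_measurable M \<and> energy M UNIV h < \<infinity>"
  unfolding square_integrable_def integrable_iff_bounded energy_def by auto

lemma square_integrable_add:
  assumes "square_integrable M u" "square_integrable M v"
  shows "square_integrable M (\<lambda>x. u x + v x)"
  unfolding square_integrable_def
proof
  show "integrable M (\<lambda>x. (norm (u x + v x))\<^sup>2)"
  proof (rule Bochner_Integration.integrable_bound)
    show "integrable M (\<lambda>x. 2 * (norm (u x))\<^sup>2 + 2 * (norm (v x))\<^sup>2)"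
      using assms by (simp add: square_integrable_def)
    show "AE x in M. norm ((norm (u x + v x))\<^sup>2) \<le> norm (2 * (norm (u x))\<^sup>2 + 2 * (norm (v x))\<^sup>2)"
      using norm_add_power2_le[of 1 "u _" "v _"] by simp
  qed (use assms in \<open>auto simp: square_integrable_def\<close>)
qed (use assms in \<open>auto simp: square_integrable_def intro: borel_measurable_add\<close>)

lemma square_integrable_diff:
  assumes "square_integrable M u" "square_integrable M v"
  shows "square_integrable M (\<lambda>x. u x - v x)"
  using square_integrable_add[OF assms(1), of "\<lambda>x. - v x"] assms(2)
  by (simp add: square_integrable_def)

lemma square_integrable_bound:
  assumes "square_integrable M u" "v \<in> borel_measurable M" "\<And>x. norm (v x) \<le> C * norm (u x)"
  shows "square_integrable M v"
  unfolding square_integrable_def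
proof
  show "integrable M (\<lambda>x. (norm (v x))\<^sup>2)"
  proof (rule Bochner_Integration.integrable_bound)
    show "integrable M (\<lambda>x. C\<^sup>2 * (norm (u x))\<^sup>2)"
      using assms by (simp add: square_integrable_def)
    show "AE x in M. norm ((norm (v x))\<^sup>2) \<le> norm (C\<^sup>2 * (norm (u x))\<^sup>2)"
      using power_mono[OF assms(3) norm_ge_zero, of _ 2] by (auto simp: power_mult_distrib)
  qed (use assms in measurable)
qed fact

lemma energy_eq_integral:
  assumes "square_integrable M h" "S \<in> sets M"
  shows "energy M S h = ennreal (\<integral>x. (norm (h x))\<^sup>2 * indicator S x \<partial>M)"
    and "integrable M (\<lambda>x. (norm (h x))\<^sup>2 * indicator S x)"
proof -
  show *: "integrable M (\<lambda>x. (norm (h x))\<^sup>2 * indicator S x)"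
    using assms by (auto simp: square_integrable_def intro!: integrable_real_mult_indicator)
  show "energy M S h = ennreal (\<integral>x. (norm (h x))\<^sup>2 * indicator S x \<partial>M)"
    unfolding energy_def
    by (subst nn_integral_eq_integral[OF *, symmetric])
      (auto intro!: nn_integral_cong split: split_indicator)
qed

section \<open>Convergence in mean square and completeness\<close>

lemma l2_tendsto_square_integrable:
  assumes h: "\<And>n. square_integrable M (h n)" and [measurable]: "f \<in> borel_measurable M"
    and lim: "l2_tendsto M h f"
  shows "square_integrable M f"
proof -
  have [measurable]: "h n \<in> borel_measurable M" for n
    using h by (simp add: square_integrable_def)
  have "\<forall>\<^sub>F n in sequentially. (\<integral>\<^sup>+x. ennreal ((norm (h n x - f x))\<^sup>2) \<partial>M) < 1"
    using lim unfolding l2_tendsto_def by (rule order_tendstoD) simp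
  then obtain n where "(\<integral>\<^sup>+x. ennreal ((norm (h n x - f x))\<^sup>2) \<partial>M) < 1"
    by (auto simp: eventually_sequentially)
  then have "energy M UNIV (\<lambda>x. h n x - f x) < \<infinity>"
    by (simp add: energy_def order.strict_trans)
  then have "square_integrable M (\<lambda>x. h n x - f x)"
    by (simp add: square_integrable_iff)
  from square_integrable_diff[OF h[of n] this] show ?thesis
    by simp
qed

text \<open>Removes the Young weight: \<open>t = sqrt D\<close> turns the right-hand side into the
  claim, and for \<open>D = 0\<close> one lets \<open>t\<close> tend to 0. The result is a bound
  that vanishes together with \<open>D\<close>.\<close>

lemma le_sqrt_if_weighted_le:
  fixes X D N :: real
  assumes "\<And>t. 0 < t \<Longrightarrow> X \<le> (1 + 1 / t) * D + t * N" and "0 \<le> D" "0 \<le> N"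
  shows "X \<le> D + sqrt D * (1 + N)"
proof (cases "D = 0")
  case True
  have "X \<le> e" if "0 < e" for e
  proof -
    \<comment> \<open>The summand 1 in \<open>1 + N\<close> keeps this choice of \<open>t\<close>
      meaningful when \<open>N = 0\<close>.\<close>
    have "X \<le> e / (1 + N) * N"
      using assms(1)[of "e / (1 + N)"] True that assms(3) by simp
    also have "\<dots> \<le> e"
      using that assms(3) by (simp add: field_simps)
    finally show ?thesis .
  qed
  then have "X \<le> 0"
    using field_le_epsilon[of X 0] by simp
  then show ?thesis
    using True by simp
next
  case False
  then have "0 < D" using assms by simp
  then have "X \<le> (1 + 1 / sqrt D) * D + sqrt D * N"
    by (intro assms(1)) simp
  also have "(1 + 1 / sqrt D) * D = D + sqrt D"
    using \<open>0 < D\<close> by (simp add: distrib_right real_div_sqrt)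
  finally show ?thesis
    by (simp add: distrib_left)
qed

text \<open>Shaped so that its integral is a hypothesis of \<open>le_sqrt_if_weighted_le\<close>:
  the difference \<open>a - b\<close> carries the large coefficient and the fixed \<open>b\<close>
  the small one.\<close>

lemma abs_diff_power2_norm_le:
  fixes a b :: complex
  assumes "0 < t"
  shows "\<bar>(norm a)\<^sup>2 - (norm b)\<^sup>2\<bar> \<le> (1 + 1 / t) * (norm (a - b))\<^sup>2 + t * (norm b)\<^sup>2"
proof -
  have 1: "(norm a)\<^sup>2 \<le> (1 + t) * (norm b)\<^sup>2 + (1 + 1 / t) * (norm (a - b))\<^sup>2"
    using norm_add_power2_le[OF assms, of b "a - b"] by simp
  have "0 \<le> (t * norm b - norm (a - b))\<^sup>2 / t"
    using assms by simp
  then have 3: "2 * norm b * norm (a - b) \<le> t * (norm b)\<^sup>2 + (norm (a - b))\<^sup>2 / t"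
    using assms by (simp add: power2_eq_square field_simps)
  have 4: "0 \<le> (norm (a - b))\<^sup>2 / t" "0 \<le> t * (norm b)\<^sup>2" "0 \<le> (norm a)\<^sup>2" "0 \<le> (norm (a - b))\<^sup>2"
    using assms by auto
  have 2: "(norm b)\<^sup>2 - (norm a)\<^sup>2 \<le> (norm (a - b))\<^sup>2 + (norm (a - b))\<^sup>2 / t + t * (norm b)\<^sup>2"
  \<comment> \<open>The reverse triangle inequality
    \<open>norm b - norm (a - b) \<le> norm a\<close> may be squared only if its left side is
    nonnegative; otherwise \<open>(norm b)\<^sup>2\<close> is already dominated by
    \<open>(norm (a - b))\<^sup>2\<close>.\<close>
  proof (cases "norm b < norm (a - b)")
    case True
    then have "(norm b)\<^sup>2 \<le> (norm (a - b))\<^sup>2"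
      by (intro power_mono) auto
    then show ?thesis
      using 4 by linarith
  next
    case False
    then have "(norm b - norm (a - b))\<^sup>2 \<le> (norm a)\<^sup>2"
      using norm_triangle_ineq2[of b "b - a"] by (intro power_mono) (auto simp: norm_minus_commute)
    then show ?thesis
      using 3 4 unfolding power2_diff by linarith
  qed
  show ?thesis
    using 1 2 by (auto simp: abs_le_iff distrib_right)
qed

text \<open>The pointwise bound on the difference of squares survives multiplication by the
  indicator of \<open>S\<close>; integrating it and optimizing the weight bounds the error by a
  quantity that tends to 0 with the mean-square distance.\<close>

lemma energy_tendsto:
  assumes h: "\<And>n. square_integrable M (h n)" and f: "square_integrable M f"
    and lim: "l2_tendsto M h f" and S: "S \<in> sets M"
  shows "(\<lambda>n. energy M S (h n)) \<longlonglongrightarrow> energy M S f"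
proof -
  define D where "D n = (\<integral>x. (norm (h n x - f x))\<^sup>2 \<partial>M)" for n
  define N where "N = (\<integral>x. (norm (f x))\<^sup>2 \<partial>M)"
  define I where "I u = (\<integral>x. (norm (u x))\<^sup>2 * indicator S x \<partial>M)" for u :: "'a \<Rightarrow> complex"
  have int: "integrable M (\<lambda>x. (norm (h n x - f x))\<^sup>2)" "integrable M (\<lambda>x. (norm (f x))\<^sup>2)" for n
    using square_integrable_diff[OF h f] f by (simp_all add: square_integrable_def)
  have "(\<lambda>n. ennreal (D n)) \<longlonglongrightarrow> 0"
    using lim unfolding l2_tendsto_def D_def by (simp add: nn_integral_eq_integral[OF int(1)])
  then have D0: "D \<longlonglongrightarrow> 0"
    by (subst (asm) ennreal_tendsto_0_iff) (simp_all add: D_def)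
  have bound: "\<bar>I (h n) - I f\<bar> \<le> D n + sqrt (D n) * (1 + N)" for n
  proof (rule le_sqrt_if_weighted_le)
    fix t :: real assume t: "0 < t"
    have "\<bar>I (h n) - I f\<bar> = \<bar>\<integral>x. (norm (h n x))\<^sup>2 * indicator S x - (norm (f x))\<^sup>2 * indicator S x \<partial>M\<bar>"
      unfolding I_def
      by (subst Bochner_Integration.integral_diff) (auto intro: energy_eq_integral(2) h f S)
    also have "\<dots> \<le> (\<integral>x. \<bar>(norm (h n x))\<^sup>2 * indicator S x - (norm (f x))\<^sup>2 * indicator S x\<bar> \<partial>M)"
      by (rule integral_abs_bound)
    also have "\<dots> \<le> (\<integral>x. (1 + 1 / t) * (norm (h n x - f x))\<^sup>2 + t * (norm (f x))\<^sup>2 \<partial>M)"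
    proof (rule integral_mono)
      fix x
      show "\<bar>(norm (h n x))\<^sup>2 * indicator S x - (norm (f x))\<^sup>2 * indicator S x\<bar>
          \<le> (1 + 1 / t) * (norm (h n x - f x))\<^sup>2 + t * (norm (f x))\<^sup>2"
        using abs_diff_power2_norm_le[OF t, of "h n x" "f x"] t by (simp split: split_indicator)
    qed (use int in \<open>auto intro!: energy_eq_integral(2) h f S\<close>)
    also have "\<dots> = (1 + 1 / t) * D n + t * N"
      using int by (simp add: D_def N_def)
    finally show "\<bar>I (h n) - I f\<bar> \<le> (1 + 1 / t) * D n + t * N" .
  qed (simp_all add: D_def N_def)
  have "(\<lambda>n. D n + sqrt (D n) * (1 + N)) \<longlonglongrightarrow> 0 + sqrt 0 * (1 + N)"
    by (intro tendsto_intros D0)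
  then have "(\<lambda>n. \<bar>I (h n) - I f\<bar>) \<longlonglongrightarrow> 0"
    using bound by (intro tendsto_sandwich[OF _ _ tendsto_const, of _ "\<lambda>n. \<bar>I (h n) - I f\<bar>"]) auto
  then have "(\<lambda>n. I (h n)) \<longlonglongrightarrow> I f"
    using LIM_zero_cancel tendsto_rabs_zero_iff by blast
  then show ?thesis
    using h f S by (simp add: energy_eq_integral I_def)
qed

text \<open>The hypothesis says that \<open>norm (d n)\<close> is at most \<open>sqrt C\<close>
  times the \<open>n\<close>-th power of \<open>1 / sqrt 2\<close>, a geometric majorant.\<close>

lemma summable_norm_if_power2_bounded:
  fixes d :: "nat \<Rightarrow> complex"
  assumes "\<And>n. 2 ^ n * (norm (d n))\<^sup>2 \<le> C"
  shows "summable (\<lambda>n. norm (d n))"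
proof (rule summable_comparison_test')
  have "0 \<le> C" using assms[of 0] by (smt (verit) zero_le_power2 mult_nonneg_nonneg zero_le_power)
  show "summable (\<lambda>n. sqrt C * (1 / sqrt 2) ^ n)"
    by (intro summable_mult summable_geometric) simp
  fix n :: nat
  assume "n \<ge> 0"
  have "(norm (d n))\<^sup>2 \<le> C / 2 ^ n"
    using assms[of n] by (simp add: field_simps)
  then have "norm (d n) \<le> sqrt (C / 2 ^ n)"
    by (rule real_le_rsqrt)
  then show "norm (norm (d n)) \<le> sqrt C * (1 / sqrt 2) ^ n"
    by (simp add: real_sqrt_divide real_sqrt_power power_one_over)
qed

text \<open>The weights \<open>2 ^ n\<close> turn geometric Cauchy rates into almost everywhere convergence.\<close>

lemma riesz_fischer_geometric:
  fixes F :: "nat \<Rightarrow> 'b \<Rightarrow> complex"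
  assumes [measurable]: "\<And>n. F n \<in> borel_measurable M"
    and "0 \<le> C"
    and cauchy: "\<And>m n. m \<le> n \<Longrightarrow> (\<integral>\<^sup>+x. ennreal ((norm (F m x - F n x))\<^sup>2) \<partial>M) \<le> ennreal (C * (1 / 4) ^ m)"
  obtains g where "g \<in> borel_measurable M" "l2_tendsto M F g"
proof
  define g where "g x = lim (\<lambda>n. F n x)" for x
  show [measurable]: "g \<in> borel_measurable M"
    unfolding g_def by measurable
  define G where "G x = (\<Sum>n. ennreal (2 ^ n * (norm (F n x - F (Suc n) x))\<^sup>2))" for x
  have "(\<integral>\<^sup>+x. G x \<partial>M) = (\<Sum>n. \<integral>\<^sup>+x. ennreal (2 ^ n * (norm (F n x - F (Suc n) x))\<^sup>2) \<partial>M)"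
    unfolding G_def by (rule nn_integral_suminf) measurable
  also have "\<dots> \<le> (\<Sum>n. ennreal (C * (1 / 2) ^ n))"
  proof (rule suminf_le)
    fix n
    have "(\<integral>\<^sup>+x. ennreal (2 ^ n * (norm (F n x - F (Suc n) x))\<^sup>2) \<partial>M)
        = ennreal (2 ^ n) * (\<integral>\<^sup>+x. ennreal ((norm (F n x - F (Suc n) x))\<^sup>2) \<partial>M)"
      by (simp add: ennreal_mult nn_integral_cmult)
    also have "\<dots> \<le> ennreal (2 ^ n) * ennreal (C * (1 / 4) ^ n)"
      by (intro mult_left_mono cauchy) simp_all
    also have "\<dots> = ennreal (C * (1 / 2) ^ n)"
    proof -
      have "(2::real) ^ n * (1 / 4) ^ n = (1 / 2) ^ n"
        by (simp add: power_mult_distrib[symmetric])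
      then show ?thesis
        using \<open>0 \<le> C\<close> by (simp add: ennreal_mult[symmetric] mult.left_commute)
    qed
    finally show "(\<integral>\<^sup>+x. ennreal (2 ^ n * (norm (F n x - F (Suc n) x))\<^sup>2) \<partial>M) \<le> ennreal (C * (1 / 2) ^ n)" .
  qed (rule summableI)+
  also have "\<dots> = ennreal (\<Sum>n. C * (1 / 2) ^ n)"
    using \<open>0 \<le> C\<close> by (intro suminf_ennreal2 summable_mult summable_geometric) simp_all
  finally have "(\<integral>\<^sup>+x. G x \<partial>M) \<noteq> \<infinity>"
    using ennreal_less_top leD by (metis infinity_ennreal_def)
  moreover have "G \<in> borel_measurable M"
    unfolding G_def by measurable
  ultimately have "AE x in M. G x \<noteq> \<infinity>"
    by (intro nn_integral_PInf_AE) auto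
  then have lim: "AE x in M. (\<lambda>n. F n x) \<longlonglongrightarrow> g x"
  proof eventually_elim
    case (elim x)
    have "2 ^ n * (norm (F n x - F (Suc n) x))\<^sup>2 \<le> enn2real (G x)" for n
    proof -
      have "ennreal (2 ^ n * (norm (F n x - F (Suc n) x))\<^sup>2) \<le> G x"
        unfolding G_def
        using sum_le_suminf[OF summableI _ zero_le, of "{n}" "\<lambda>n. ennreal (2 ^ n * (norm (F n x - F (Suc n) x))\<^sup>2)"]
        by (simp only: finite.intros sum.insert sum.empty empty_iff add_0_right simp_thms)
      then show ?thesis
        using elim by (cases "G x" rule: ennreal_cases) simp_all
    qed
    then have "summable (\<lambda>n. norm (F n x - F (Suc n) x))"
      by (rule summable_norm_if_power2_bounded)
    then have "summable (\<lambda>n. norm (F (Suc n) x - F n x))"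
      by (simp add: norm_minus_commute)
    then have "convergent (\<lambda>n. F n x)"
    proof -
      assume "summable (\<lambda>n. norm (F (Suc n) x - F n x))"
      then have "summable (\<lambda>n. F (Suc n) x - F n x)"
        by (rule summable_norm_cancel)
      then have "convergent (\<lambda>n. F n x - F 0 x)"
        using sum_lessThan_telescope[of "\<lambda>n. F n x"] by (simp add: summable_iff_convergent)
      then show ?thesis
        using convergent_add[of "\<lambda>n. F n x - F 0 x" "\<lambda>_. F 0 x"] by (simp add: convergent_const)
    qed
    then show ?case
      unfolding g_def by (simp add: convergent_LIMSEQ_iff)
  qed
  \<comment> \<open>Fatou's lemma: the Cauchy estimate between \<open>F m\<close> and
    \<open>F n\<close> passes to the almost everywhere limit in \<open>n\<close>.\<close>
  have bound: "(\<integral>\<^sup>+x. ennreal ((norm (F m x - g x))\<^sup>2) \<partial>M) \<le> ennreal (C * (1 / 4) ^ m)" for m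
  proof -
    have "(\<integral>\<^sup>+x. ennreal ((norm (F m x - g x))\<^sup>2) \<partial>M)
        = (\<integral>\<^sup>+x. liminf (\<lambda>n. ennreal ((norm (F m x - F n x))\<^sup>2)) \<partial>M)"
    proof (rule nn_integral_cong_AE)
      show "AE x in M. ennreal ((norm (F m x - g x))\<^sup>2) = liminf (\<lambda>n. ennreal ((norm (F m x - F n x))\<^sup>2))"
        using lim
      proof eventually_elim
        case (elim x)
        then have "(\<lambda>n. ennreal ((norm (F m x - F n x))\<^sup>2)) \<longlonglongrightarrow> ennreal ((norm (F m x - g x))\<^sup>2)"
          by (intro tendsto_intros tendsto_ennrealI)
        then show ?case
          by (rule lim_imp_Liminf[OF sequentially_bot, symmetric])
      qed
    qed
    also have "\<dots> \<le> liminf (\<lambda>n. \<integral>\<^sup>+x. ennreal ((norm (F m x - F n x))\<^sup>2) \<partial>M)"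
      by (rule nn_integral_liminf) measurable
    also have "\<dots> \<le> ennreal (C * (1 / 4) ^ m)"
      using cauchy by (intro Liminf_le) (auto simp: eventually_sequentially)
    finally show ?thesis .
  qed
  have "(\<lambda>m. C * (1 / 4) ^ m) \<longlonglongrightarrow> C * 0"
    by (intro tendsto_intros LIMSEQ_power_zero) simp
  then have "(\<lambda>m. ennreal (C * (1 / 4) ^ m)) \<longlonglongrightarrow> ennreal 0"
    by (intro tendsto_ennrealI) simp
  then have lim0: "(\<lambda>m. ennreal (C * (1 / 4) ^ m)) \<longlonglongrightarrow> 0"
    by (simp only: ennreal_0)
  show "l2_tendsto M F g"
    unfolding l2_tendsto_def
    using lim0 bound by (rule ennreal_tendsto_0_le)
qed

section \<open>Discs and Haar measure\<close>

lemma borel_measurable_diff_field [measurable (raw)]: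
  fixes f g :: "'b \<Rightarrow> 'a::td_local_field"
  assumes "f \<in> borel_measurable M" "g \<in> borel_measurable M"
  shows "(\<lambda>x. f x - g x) \<in> borel_measurable M"
  using assms
  by (rule borel_measurable_continuous_Pair) (intro continuous_intros)

lemma borel_measurable_mult_field [measurable (raw)]:
  fixes f g :: "'b \<Rightarrow> 'a::td_local_field"
  assumes "f \<in> borel_measurable M" "g \<in> borel_measurable M"
  shows "(\<lambda>x. f x * g x) \<in> borel_measurable M"
  using assms
  by (rule borel_measurable_continuous_Pair)
    (unfold continuous_on_def, intro ballI tendsto_mult tendsto_fst tendsto_snd tendsto_ident_at)

text \<open>\<open>haar_measure\<close> speaks of images of sets, while a change of variables needs
  preimages; the preimage under translation by \<open>c\<close> is the image under translation by
  \<open>- c\<close>.\<close>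

lemma haar_measure_distr_add:
  fixes \<mu> :: "'a::td_local_field measure"
  assumes "haar_measure \<mu>"
  shows "distr \<mu> \<mu> (\<lambda>y. c + y) = \<mu>"
proof (rule measure_eqI)
  have [measurable_cong]: "sets \<mu> = sets borel"
    using assms by (simp add: haar_measure_def)
  have [measurable]: "(\<lambda>y. c + y) \<in> measurable borel (borel :: 'a measure)"
    by (intro borel_measurable_continuous_onI continuous_intros)
  fix A assume "A \<in> sets (distr \<mu> \<mu> (\<lambda>y. c + y))"
  then have A[measurable]: "A \<in> sets borel"
    by (simp add: \<open>sets \<mu> = sets borel\<close>)
  have sp: "space \<mu> = UNIV"
    using sets_eq_imp_space_eq[OF \<open>sets \<mu> = sets borel\<close>] by simp
  have "x \<in> (\<lambda>y. - c + y) ` A" if "c + x \<in> A" for x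
    using that by (intro image_eqI[of _ _ "c + x"]) simp_all
  then have eq: "(\<lambda>y. c + y) -` A = (\<lambda>y. - c + y) ` A"
    by auto
  then show "emeasure (distr \<mu> \<mu> (\<lambda>y. c + y)) A = emeasure \<mu> A"
    using assms A unfolding haar_measure_def by (subst emeasure_distr) (simp_all only: eq sp Int_UNIV_right, simp_all)
qed simp

lemma (in pair_sigma_finite) integrable_fst_mult_snd:
  fixes u :: "'a \<Rightarrow> complex" and v :: "'b \<Rightarrow> complex"
  assumes [measurable]: "integrable M1 u" "integrable M2 v"
  shows "integrable (M1 \<Otimes>\<^sub>M M2) (\<lambda>p. u (fst p) * v (snd p))"
    and "(\<integral>p. u (fst p) * v (snd p) \<partial>(M1 \<Otimes>\<^sub>M M2)) = (\<integral>x. u x \<partial>M1) * (\<integral>y. v y \<partial>M2)"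
proof -
  show *: "integrable (M1 \<Otimes>\<^sub>M M2) (\<lambda>p. u (fst p) * v (snd p))"
  proof (rule Fubini_integrable)
    show "integrable M1 (\<lambda>x. \<integral>y. norm (u (fst (x, y)) * v (snd (x, y))) \<partial>M2)"
      using assms by (simp add: norm_mult)
  qed (use assms in simp_all)
  have "(\<integral>p. u (fst p) * v (snd p) \<partial>(M1 \<Otimes>\<^sub>M M2)) = (\<integral>x. (\<integral>y. u x * v y \<partial>M2) \<partial>M1)"
    using integral_fst'[OF *] by simp
  also have "\<dots> = (\<integral>x. u x \<partial>M1) * (\<integral>y. v y \<partial>M2)"
    by simp
  finally show "(\<integral>p. u (fst p) * v (snd p) \<partial>(M1 \<Otimes>\<^sub>M M2)) = (\<integral>x. u x \<partial>M1) * (\<integral>y. v y \<partial>M2)" .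
qed

context local_field_data
begin

lemma sets_haar [measurable_cong, simp]: "sets \<mu> = sets borel"
  using haar by (simp add: haar_measure_def)

lemma space_haar [simp]: "space \<mu> = UNIV"
  using sets_eq_imp_space_eq[OF sets_haar] by simp

lemma q_ge_2: "2 \<le> real q"
proof -
  obtain p k where p: "prime (p::nat)" "k \<ge> 1" "q = p ^ k"
    using prime_power by blast
  then have "2 \<le> p" by (simp add: prime_ge_2_nat)
  then have "2 \<le> q" using p self_le_power[of p k] by linarith
  then show ?thesis by simp
qed

lemma q_gt_1: "1 < real q" and q_pos: "0 < real q" and q_neq_0: "real q \<noteq> 0"
  using q_ge_2 by auto

lemma q_powi_pos: "0 < real q powi k"
  using q_pos by simp

lemma q_powi_le_iff: "real q powi j \<le> real q powi k \<longleftrightarrow> j \<le> k"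
  using power_int_strict_increasing[of k j "real q"] power_int_increasing[of j k "real q"] q_gt_1
  by fastforce

lemma absv_0 [simp]: "absv 0 = 0"
  by (simp add: absv_eq_0_iff)

lemma absv_1 [simp]: "absv 1 = 1"
  using absv_mult[of 1 1] absv_eq_0_iff[of 1] by simp

lemma absv_minus [simp]: "absv (- x) = absv x"
proof -
  have "absv (-1) ^ 2 = 1" using absv_mult[of "-1" "-1"] by (simp add: power2_eq_square)
  then have "absv (-1) = 1" using absv_nonneg[of "-1"] by (simp add: power2_eq_1_iff)
  then show ?thesis using absv_mult[of "-1" x] by simp
qed

lemma absv_minus_commute: "absv (x - y) = absv (y - x)"
  by (metis absv_minus minus_diff_eq)

lemma ultrametric_diff: "absv (x - z) \<le> max (absv (x - y)) (absv (y - z))"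
  using ultrametric[of "x - y" "y - z"] by simp

lemma absv_values:
  assumes "x \<noteq> 0"
  obtains k where "absv x = real q powi k"
proof -
  have "absv x \<in> insert 0 (range (\<lambda>k::int. real q powi k))"
    using value_group by blast
  then show ?thesis
    using assms that absv_eq_0_iff by auto
qed

lemma ex_absv_eq: obtains c where "absv c = real q powi k" "c \<noteq> 0"
proof -
  have "real q powi k \<in> range absv"
    using value_group by blast
  then show ?thesis
    using that absv_0 q_powi_pos[of k] by (metis imageE less_irrefl)
qed

lemma continuous_on_absv: "continuous_on UNIV absv"
proof (rule continuous_on_open_vimage[THEN iffD2, rule_format])
  fix B :: "real set"
  assume "open B"
  have "\<exists>e>0. \<forall>y. absv (y - x) < e \<longrightarrow> y \<in> absv -` B" if x: "absv x \<in> B" for x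
  proof -
    obtain e where e: "e > 0" "\<And>r. dist r (absv x) < e \<Longrightarrow> r \<in> B"
      using \<open>open B\<close> x by (meson open_dist)
    have "absv y \<in> B" if y: "absv (y - x) < e" for y
    proof (rule e)
      \<comment> \<open>Both directions of the ultrametric inequality: whichever of the two values
        is larger, it is below \<open>e\<close> or not larger after all, so they differ by less than
        \<open>e\<close>.\<close>
      have "absv y \<le> max (absv (y - x)) (absv x)" "absv x \<le> max (absv (y - x)) (absv y)"
        using ultrametric_diff[of y 0 x] ultrametric_diff[of x 0 y]
        by (simp_all add: absv_minus_commute)
      then show "dist (absv y) (absv x) < e"
        using y absv_nonneg[of x] absv_nonneg[of y] e(1) by (auto simp: dist_real_def max_def split: if_splits)
    qed
    then show ?thesis using e(1) by auto
  qed
  then show "open (absv -` B \<inter> UNIV)"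
    by (simp add: topology)
qed simp

lemma measurable_absv [measurable]: "absv \<in> borel_measurable borel"
  by (rule borel_measurable_continuous_onI[OF continuous_on_absv])

lemma measurable_character [measurable]: "\<psi> \<in> borel_measurable borel"
  by (rule borel_measurable_continuous_onI[OF character_continuous])

text \<open>Discs are indexed by the exponent of their radius. Since the nonzero values are the
  powers of \<open>q\<close>, this covers all radii, and exponents of dual discs are simply
  negatives of each other.\<close>

definition disc :: "'a \<Rightarrow> int \<Rightarrow> 'a set"
  where "disc a k = {x. absv (x - a) \<le> real q powi k}"

lemma disc_sets [measurable]: "disc a k \<in> sets borel"
  unfolding disc_def by measurable

lemma disc_0_eq_scaled:
  assumes c: "absv c = real q powi k" "c \<noteq> 0"
  shows "disc 0 k = (\<lambda>y. c * y) ` {x. absv x \<le> 1}"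
proof (intro equalityI subsetI)
  fix x assume x: "x \<in> disc 0 k"
  have "absv (x / c) * absv c = absv x"
    using c absv_mult[of "x / c" c] by simp
  then have "absv (x / c) * real q powi k \<le> 1 * real q powi k"
    using x c by (simp add: disc_def)
  then have "absv (x / c) \<le> 1"
    using q_powi_pos[of k] by (rule mult_right_le_imp_le)
  moreover have "x = c * (x / c)"
    using c by simp
  ultimately show "x \<in> (\<lambda>y. c * y) ` {x. absv x \<le> 1}" by blast
next
  fix x assume "x \<in> (\<lambda>y. c * y) ` {x. absv x \<le> 1}"
  then show "x \<in> disc 0 k"
    using c q_powi_pos[of k] by (auto simp: disc_def absv_mult mult_left_le)
qed

lemma disc_eq_translate: "disc a k = (\<lambda>y. a + y) ` disc 0 k"
proof (intro equalityI subsetI)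
  fix x assume "x \<in> disc a k"
  then have "x = a + (x - a)" "x - a \<in> disc 0 k" by (auto simp: disc_def)
  then show "x \<in> (\<lambda>y. a + y) ` disc 0 k" by blast
qed (auto simp: disc_def)

text \<open>Every power of \<open>q\<close> is the absolute value of some \<open>c\<close>, and
  \<open>c\<close> times the unit disc is the disc of that radius; \<open>scaling\<close> and
  \<open>normalized\<close> then make the measure equal to the radius.\<close>

lemma emeasure_disc: "emeasure \<mu> (disc a k) = ennreal (real q powi k)"
proof -
  obtain c where c: "absv c = real q powi k" "c \<noteq> 0"
    by (rule ex_absv_eq)
  have "emeasure \<mu> (disc a k) = emeasure \<mu> (disc 0 k)"
    using haar disc_sets[of 0 k] by (subst disc_eq_translate) (simp add: haar_measure_def)
  also have "\<dots> = ennreal (absv c)"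
    using scaling[of "{x. absv x \<le> 1}" c] normalized
    by (simp add: disc_0_eq_scaled[OF c])
  finally show ?thesis using c by simp
qed

lemma mem_disc_commute: "x \<in> disc y k \<longleftrightarrow> y \<in> disc x k"
  by (simp add: disc_def absv_minus_commute)

lemma disc_mono: "j \<le> k \<Longrightarrow> disc a j \<subseteq> disc a k"
  using q_powi_le_iff[of j k] by (auto simp: disc_def)

text \<open>Every point of an ultrametric disc is a centre of it. One inclusion suffices because
  membership is symmetric in point and centre.\<close>

lemma disc_eq:
  assumes "b \<in> disc a k"
  shows "disc b k = disc a k"
proof -
  have "disc b k \<subseteq> disc a k" if "b \<in> disc a k" for a b
  proof
    fix x assume "x \<in> disc b k"
    then show "x \<in> disc a k"
      using ultrametric_diff[of x a b] that by (simp add: disc_def)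
  qed
  then show ?thesis
    using assms mem_disc_commute by (simp add: subset_antisym)
qed

lemma disc_disjoint_or_subset:
  assumes "j \<le> k"
  shows "disc a j \<inter> disc b k = {} \<or> disc a j \<subseteq> disc b k"
proof (cases "disc a j \<inter> disc b k = {}")
  case False
  then obtain c where c: "c \<in> disc a j" "c \<in> disc b k" by blast
  then have "disc a j \<subseteq> disc b k"
    using disc_mono[OF assms, of c] by (simp add: disc_eq)
  then show ?thesis by simp
qed simp

text \<open>No value lies strictly between consecutive powers of \<open>q\<close>. This gain of a
  factor \<open>q\<close> over the radius is used in the Chebyshev estimate and in the orthogonality
  of characters.\<close>

lemma not_in_disc:
  assumes "x \<notin> disc a k"
  shows "real q powi (k + 1) \<le> absv (x - a)"
proof -
  have "x \<noteq> a"
    using assms q_powi_pos[of k] by (auto simp: disc_def)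
  then obtain j where j: "absv (x - a) = real q powi j"
    using absv_values[of "x - a"] by auto
  then have "k < j"
    using assms q_powi_le_iff by (auto simp: disc_def not_le)
  then show ?thesis
    using j q_powi_le_iff by simp
qed

lemma ex_powi_less:
  assumes "e > 0" obtains k :: nat where "real q powi (- int k) < e"
proof -
  obtain k where "(1 / real q) ^ k < e"
    using real_arch_pow_inv[OF assms] q_gt_1 by (metis divide_less_eq_1_pos less_trans zero_less_one)
  then show ?thesis
    using that[of k] by (simp add: power_int_minus power_one_over field_simps)
qed

lemma in_disc_eventually: "\<exists>k0. \<forall>k\<ge>k0. x \<in> disc a (int k)"
proof -
  obtain k0 where k0: "absv (x - a) < real q ^ k0"
    using real_arch_pow[OF q_gt_1] by blast
  have "x \<in> disc a (int k)" if "k \<ge> k0" for k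
  proof -
    have "real q ^ k0 \<le> real q ^ k"
      using that q_gt_1 by (intro power_increasing) auto
    then show ?thesis
      using k0 by (simp add: disc_def)
  qed
  then show ?thesis by blast
qed

lemma UN_disc: "(\<Union>k::nat. disc a (int k)) = UNIV"
  using in_disc_eventually by blast

lemma sigma_finite_haar: "sigma_finite_measure \<mu>"
proof
  show "\<exists>A. countable A \<and> A \<subseteq> sets \<mu> \<and> \<Union> A = space \<mu> \<and> (\<forall>a\<in>A. emeasure \<mu> a \<noteq> \<infinity>)"
    using UN_disc[of 0]
    by (intro exI[of _ "range (\<lambda>k::nat. disc 0 (int k))"]) (auto simp: emeasure_disc)
qed

text \<open>A point lies in discs of arbitrarily small measure. Needed because the weight
  \<open>absv (x - a)\<close> of a second moment vanishes at \<open>a\<close>.\<close>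

lemma emeasure_singleton: "emeasure \<mu> {a} = 0"
proof (rule ccontr)
  assume "emeasure \<mu> {a} \<noteq> 0"
  moreover have le: "emeasure \<mu> {a} \<le> ennreal (real q powi k)" for k
    unfolding emeasure_disc[of a k, symmetric]
    using q_powi_pos[of k] by (intro emeasure_mono) (auto simp: disc_def)
  then have "emeasure \<mu> {a} \<noteq> \<infinity>"
    by (metis ennreal_less_top leD infinity_ennreal_def)
  ultimately have pos: "0 < enn2real (emeasure \<mu> {a})" 
    by (simp add: enn2real_positive_iff less_top zero_less_iff_neq_zero)
  then obtain k :: nat where "real q powi (- int k) < enn2real (emeasure \<mu> {a})"
    by (rule ex_powi_less)
  moreover have "enn2real (emeasure \<mu> {a}) \<le> real q powi (- int k)"
    using le[of "- int k"] q_powi_pos[of "- int k"] by (intro enn2real_leI) auto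
  ultimately show False by simp
qed

lemma open_disc: "open (disc a k)"
  unfolding topology
proof (intro ballI exI[of _ "real q powi k"] conjI allI impI)
  fix x y assume "x \<in> disc a k" "absv (y - x) < real q powi k"
  then show "y \<in> disc a k"
    using disc_eq[of x a k] by (metis disc_def less_imp_le mem_Collect_eq)
qed (rule q_powi_pos)

text \<open>Every open set is a union of discs, and second countability (Lindelof) reduces the union
  to a countable one. Together with intersection-stability this permits induction over Borel sets
  from discs; the empty set is added to the generator since disjoint discs meet in it.\<close>

lemma borel_eq_sigma_discs:
  "sets borel = sigma_sets UNIV (insert {} (range (\<lambda>(a, k). disc a k)))" (is "_ = sigma_sets _ ?G")
proof (intro equalityI)
  show "sigma_sets UNIV ?G \<subseteq> sets borel"
  proof -
    have "?G \<subseteq> sets borel" by auto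
    then show ?thesis
      using sets.sigma_sets_subset[of ?G "borel :: 'a measure"] by simp
  qed
  have "S \<in> sigma_sets UNIV ?G" if "open S" for S :: "'a set"
  proof -
    define \<F> where "\<F> = {D \<in> ?G. D \<subseteq> S}"
    have "open D" if "D \<in> \<F>" for D
      using that open_disc by (auto simp: \<F>_def)
    then obtain \<F>' where \<F>': "\<F>' \<subseteq> \<F>" "countable \<F>'" "\<Union>\<F>' = \<Union>\<F>"
      by (rule Lindelof)
    have "x \<in> \<Union>\<F>" if x: "x \<in> S" for x
    proof -
      obtain e where e: "e > 0" "\<And>y. absv (y - x) < e \<Longrightarrow> y \<in> S"
        using topology[of S] \<open>open S\<close> x by auto
      obtain k :: nat where "real q powi (- int k) < e"
        using e(1) by (rule ex_powi_less)
      then have "disc x (- int k) \<subseteq> S"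
        using e(2) by (force simp: disc_def)
      moreover have "x \<in> disc x (- int k)"
        using q_powi_pos[of "- int k"] by (simp add: disc_def)
      moreover have "disc x (- int k) \<in> ?G"
        by (intro insertI2 image_eqI[of _ _ "(x, - int k)"]) simp_all
      ultimately show ?thesis
        unfolding \<F>_def by (intro UnionI[of "disc x (- int k)"]) simp_all
    qed
    moreover have "\<Union>\<F> \<subseteq> S"
      by (auto simp: \<F>_def)
    ultimately have "S = \<Union>\<F>'"
      using \<F>'(3) by blast
    moreover have "\<Union>\<F>' \<in> sigma_sets UNIV ?G"
      using \<F>' by (intro sigma_sets_UNION) (auto simp: \<F>_def intro: sigma_sets.Basic)
    ultimately show ?thesis by simp
  qed
  then show "sets borel \<subseteq> sigma_sets UNIV ?G"
    unfolding borel_def by (subst sets_measure_of) (auto intro!: sigma_sets_mono)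
qed

lemma Int_stable_discs: "Int_stable (insert {} (range (\<lambda>(a, k). disc a k)))"
proof -
  have "disc a j \<inter> disc b k \<in> insert {} (range (\<lambda>(a, k). disc a k))" for a b j k
  proof -
    have "disc a j \<inter> disc b k = {} \<or> disc a j \<inter> disc b k = disc a j \<or> disc a j \<inter> disc b k = disc b k"
      using disc_disjoint_or_subset[of j k a b] disc_disjoint_or_subset[of k j b a] by force
    then show ?thesis by auto
  qed
  then show ?thesis
    unfolding Int_stable_def by auto
qed

section \<open>Plancherel theorem\<close>

interpretation haar: sigma_finite_measure \<mu>
  by (rule sigma_finite_haar)

interpretation haar_pair: pair_sigma_finite \<mu> \<mu> ..

section \<open>Characters on discs and the Fourier integral\<close>

lemma character_0: "\<psi> 0 = 1"
  by (simp add: character_trivial)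

lemma character_minus: "\<psi> (- x) = cnj (\<psi> x)"
proof -
  have "\<psi> x * \<psi> (- x) = 1"
    using character_add[of x "- x"] by (simp add: character_0)
  moreover have "\<psi> x * cnj (\<psi> x) = 1"
    by (simp add: complex_norm_square[symmetric] character_norm)
  ultimately show ?thesis
    by (metis mult_cancel_left zero_neq_one mult_zero_left)
qed

lemma integral_translate:
  fixes u :: "'a \<Rightarrow> complex"
  assumes [measurable]: "u \<in> borel_measurable borel"
  shows "(\<integral>x. u (c + x) \<partial>\<mu>) = (\<integral>x. u x \<partial>\<mu>)"
proof -
  have [measurable]: "(\<lambda>y. c + y) \<in> measurable borel (borel :: 'a measure)"
    by (intro borel_measurable_continuous_onI continuous_intros)
  have "(\<integral>x. u x \<partial>distr \<mu> \<mu> (\<lambda>y. c + y)) = (\<integral>x. u (c + x) \<partial>\<mu>)"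
    by (rule integral_distr) measurable
  then show ?thesis
    by (simp add: haar_measure_distr_add[OF haar])
qed

lemma measure_disc: "measure \<mu> (disc a k) = real q powi k"
  using q_powi_pos[of k] by (simp add: measure_def emeasure_disc)

lemma disc_0_add:
  assumes "c \<in> disc 0 n"
  shows "c + x \<in> disc 0 n \<longleftrightarrow> x \<in> disc 0 n"
  using ultrametric[of c x] ultrametric[of "- c" "c + x"] assms by (auto simp: disc_def)

lemma disc_0_mult:
  assumes "x \<in> disc 0 n" "z \<in> disc 0 (- n)"
  shows "absv (x * z) \<le> 1"
proof -
  have "absv x * absv z \<le> real q powi n * real q powi (- n)"
    using assms absv_nonneg q_powi_pos[of n] by (intro mult_mono) (auto simp: disc_def)
  then show ?thesis
    using q_pos by (simp add: absv_mult power_int_minus)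
qed

text \<open>Orthogonality of characters. For \<open>z\<close> in the dual disc the integrand is 1 on
  \<open>disc 0 n\<close>. Otherwise some translation preserves the disc and multiplies the integral
  by a constant different from 1, so the integral is 0.\<close>

lemma integral_character_disc:
  "(\<integral>\<xi>. indicator (disc 0 n) \<xi> * cnj (\<psi> (\<xi> * z)) \<partial>\<mu>)
    = of_real (real q powi n * indicator (disc 0 (- n)) z)" (is "?I = _")
proof (cases "z \<in> disc 0 (- n)")
  case True
  have "?I = (\<integral>\<xi>. of_real (indicator (disc 0 n) \<xi>) \<partial>\<mu>)"
    using disc_0_mult[OF _ True]
    by (intro Bochner_Integration.integral_cong) (auto simp: character_trivial split: split_indicator)
  also have "\<dots> = of_real (real q powi n)"
    by (simp add: measure_disc)
  finally show ?thesis
    using True by simp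
next
  case False
  obtain x0 where x0: "absv x0 \<le> real q" "\<psi> x0 \<noteq> 1"
    using character_nontrivial by blast
  have z: "real q powi (1 - n) \<le> absv z"
    using not_in_disc[OF False] by simp
  then have "z \<noteq> 0"
    using q_powi_pos[of "1 - n"] by auto
  \<comment> \<open>The translation that moves \<open>\<xi> * z\<close> by \<open>x0\<close>. It
    stays in the disc: \<open>z\<close> lies outside radius \<open>q powi (- n)\<close>, hence has
    value at least \<open>q powi (1 - n)\<close>, which exactly compensates
    \<open>absv x0 \<le> q\<close>.\<close>
  define c where "c = x0 / z"
  have "c * z = x0"
    using \<open>z \<noteq> 0\<close> by (simp add: c_def)
  then have "absv c * absv z \<le> real q"
    using x0 absv_mult[of c z] by simp
  then have "absv c * real q powi (1 - n) \<le> real q"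
    using mult_left_mono[OF z absv_nonneg[of c]] by linarith
  then have "c \<in> disc 0 n"
    using q_pos by (simp add: disc_def power_int_diff field_simps)
  have "?I = (\<integral>\<xi>. indicator (disc 0 n) (c + \<xi>) * cnj (\<psi> ((c + \<xi>) * z)) \<partial>\<mu>)"
    by (rule integral_translate[symmetric]) measurable
  also have "\<dots> = (\<integral>\<xi>. cnj (\<psi> x0) * (indicator (disc 0 n) \<xi> * cnj (\<psi> (\<xi> * z))) \<partial>\<mu>)"
    using disc_0_add[OF \<open>c \<in> disc 0 n\<close>] \<open>c * z = x0\<close>
    by (intro Bochner_Integration.integral_cong) (auto simp: indicator_def distrib_right character_add)
  also have "\<dots> = cnj (\<psi> x0) * ?I"
    by simp
  finally have "(1 - cnj (\<psi> x0)) * ?I = 0"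
    by (simp add: algebra_simps)
  moreover have "cnj (\<psi> x0) \<noteq> 1"
    using x0 by (metis complex_cnj_one complex_cnj_cancel_iff)
  ultimately show ?thesis
    using False by simp
qed

lemma integrable_mult_character:
  assumes "integrable \<mu> h"
  shows "integrable \<mu> (\<lambda>x. h x * cnj (\<psi> (\<xi> * x)))"
proof (rule Bochner_Integration.integrable_bound[OF assms])
  show "(\<lambda>x. h x * cnj (\<psi> (\<xi> * x))) \<in> borel_measurable \<mu>"
    using borel_measurable_integrable[OF assms] by measurable
qed (simp add: norm_mult character_norm)

lemma measurable_fourier_integral [measurable]:
  assumes [measurable]: "h \<in> borel_measurable borel"
  shows "fourier_integral \<mu> \<psi> h \<in> borel_measurable borel"
  unfolding fourier_integral_def by measurable

lemma fourier_integral_add: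
  assumes "integrable \<mu> u" "integrable \<mu> v"
  shows "fourier_integral \<mu> \<psi> (\<lambda>x. u x + v x) = (\<lambda>\<xi>. fourier_integral \<mu> \<psi> u \<xi> + fourier_integral \<mu> \<psi> v \<xi>)"
  using integrable_mult_character[OF assms(1)] integrable_mult_character[OF assms(2)]
  by (simp add: fourier_integral_def distrib_right fun_eq_iff)

lemma fourier_integral_diff:
  assumes "integrable \<mu> u" "integrable \<mu> v"
  shows "fourier_integral \<mu> \<psi> (\<lambda>x. u x - v x) = (\<lambda>\<xi>. fourier_integral \<mu> \<psi> u \<xi> - fourier_integral \<mu> \<psi> v \<xi>)"
  using integrable_mult_character[OF assms(1)] integrable_mult_character[OF assms(2)]
  by (simp add: fourier_integral_def left_diff_distrib fun_eq_iff)

lemma norm_fourier_integral_le: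
  "norm (fourier_integral \<mu> \<psi> h \<xi>) \<le> (\<integral>x. norm (h x) \<partial>\<mu>)"
  unfolding fourier_integral_def
  by (rule order_trans[OF integral_norm_bound]) (simp add: norm_mult character_norm)

section \<open>The Plancherel identity on discs\<close>

lemma q_powi_cancel: "real q powi n * real q powi (- n) = 1"
  using q_neq_0 by (simp add: power_int_add[symmetric])

text \<open>By \<open>integral_character_disc\<close> this is the transform of the indicator of
  \<open>disc 0 n\<close> at the difference of the two coordinates. In either variable it is the
  density of the uniform distribution on a disc of radius \<open>q powi (- n)\<close>.\<close>

definition disc_kernel :: "int \<Rightarrow> 'a \<times> 'a \<Rightarrow> real"
  where "disc_kernel n p = real q powi n * indicator (disc 0 (- n)) (fst p - snd p)"

lemma disc_kernel_nonneg: "0 \<le> disc_kernel n p"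
  using q_powi_pos[of n] by (simp add: disc_kernel_def)

lemma measurable_disc_kernel [measurable]: "disc_kernel n \<in> borel_measurable (borel \<Otimes>\<^sub>M borel)"
  unfolding disc_kernel_def by measurable

lemma nn_integral_disc_kernel: "(\<integral>\<^sup>+y. ennreal (disc_kernel n (x, y)) \<partial>\<mu>) = 1" "(\<integral>\<^sup>+y. ennreal (disc_kernel n (y, x)) \<partial>\<mu>) = 1"
proof -
  have *: "(\<integral>\<^sup>+y. ennreal (real q powi n) * indicator (disc x (- n)) y \<partial>\<mu>) = 1"
    using q_powi_pos[of n] q_powi_pos[of "- n"] q_powi_cancel[of n]
    by (simp add: nn_integral_cmult emeasure_disc ennreal_mult[symmetric])
  show "(\<integral>\<^sup>+y. ennreal (disc_kernel n (x, y)) \<partial>\<mu>) = 1" "(\<integral>\<^sup>+y. ennreal (disc_kernel n (y, x)) \<partial>\<mu>) = 1"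
    unfolding *[symmetric]
    by (intro nn_integral_cong; simp add: disc_kernel_def disc_def absv_minus_commute split: split_indicator)+
qed

lemma nn_integral_disc_kernel_marginal:
  assumes [measurable]: "u \<in> borel_measurable borel"
  shows "(\<integral>\<^sup>+p. ennreal (disc_kernel n p) * u (fst p) \<partial>(\<mu> \<Otimes>\<^sub>M \<mu>)) = (\<integral>\<^sup>+x. u x \<partial>\<mu>)"
    and "(\<integral>\<^sup>+p. ennreal (disc_kernel n p) * u (snd p) \<partial>(\<mu> \<Otimes>\<^sub>M \<mu>)) = (\<integral>\<^sup>+x. u x \<partial>\<mu>)"
proof -
  have "(\<integral>\<^sup>+p. ennreal (disc_kernel n p) * u (fst p) \<partial>(\<mu> \<Otimes>\<^sub>M \<mu>))
      = (\<integral>\<^sup>+x. (\<integral>\<^sup>+y. ennreal (disc_kernel n (x, y)) * u x \<partial>\<mu>) \<partial>\<mu>)"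
    by (subst haar.nn_integral_fst[symmetric]) simp_all
  then show "(\<integral>\<^sup>+p. ennreal (disc_kernel n p) * u (fst p) \<partial>(\<mu> \<Otimes>\<^sub>M \<mu>)) = (\<integral>\<^sup>+x. u x \<partial>\<mu>)"
    by (simp add: nn_integral_multc nn_integral_disc_kernel)
  have "(\<integral>\<^sup>+p. ennreal (disc_kernel n p) * u (snd p) \<partial>(\<mu> \<Otimes>\<^sub>M \<mu>))
      = (\<integral>\<^sup>+y. (\<integral>\<^sup>+x. ennreal (disc_kernel n (x, y)) * u y \<partial>\<mu>) \<partial>\<mu>)"
    by (subst haar_pair.nn_integral_snd[symmetric]) simp_all
  then show "(\<integral>\<^sup>+p. ennreal (disc_kernel n p) * u (snd p) \<partial>(\<mu> \<Otimes>\<^sub>M \<mu>)) = (\<integral>\<^sup>+x. u x \<partial>\<mu>)"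
    by (simp add: nn_integral_multc nn_integral_disc_kernel)
qed

text \<open>A mean-square modulus of continuity: the average over
  \<open>absv t \<le> q powi (- n)\<close> of the squared distance between \<open>h\<close> and its
  translate by \<open>t\<close>.\<close>

definition modulus :: "int \<Rightarrow> ('a \<Rightarrow> complex) \<Rightarrow> ennreal"
  where "modulus n h = (\<integral>\<^sup>+p. ennreal (disc_kernel n p * (norm (h (fst p) - h (snd p)))\<^sup>2) \<partial>(\<mu> \<Otimes>\<^sub>M \<mu>))"

text \<open>The squared modulus of the transform is a double integral of
  \<open>h (fst p) * cnj (h (snd p))\<close> against the character at
  \<open>\<xi> * (fst p - snd p)\<close>; integrating over \<open>\<xi>\<close> first leaves the
  kernel by orthogonality.\<close>

lemma integral_fourier_disc:
  assumes h: "integrable \<mu> h"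
  shows "(\<integral>\<xi>. indicator (disc 0 n) \<xi> * (fourier_integral \<mu> \<psi> h \<xi> * cnj (fourier_integral \<mu> \<psi> h \<xi>)) \<partial>\<mu>)
    = (\<integral>p. of_real (disc_kernel n p) * (h (fst p) * cnj (h (snd p))) \<partial>(\<mu> \<Otimes>\<^sub>M \<mu>))"
proof -
  interpret P: pair_sigma_finite "\<mu> \<Otimes>\<^sub>M \<mu>" \<mu>
    by (intro pair_sigma_finite.intro sigma_finite_pair_measure sigma_finite_haar)
  have [measurable]: "h \<in> borel_measurable borel"
    using borel_measurable_integrable[OF h] by simp
  define H where "H p = h (fst p) * cnj (h (snd p))" for p
  have H: "integrable (\<mu> \<Otimes>\<^sub>M \<mu>) H"
    unfolding H_def using h by (intro haar_pair.integrable_fst_mult_snd) simp_all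
  have D: "integrable \<mu> (\<lambda>\<xi>. indicator (disc 0 n) \<xi> :: complex)"
  proof -
    have "integrable \<mu> (\<lambda>\<xi>. of_real (indicator (disc 0 n) \<xi>) :: complex)"
      by (intro integrable_of_real integrable_real_indicator) (simp_all add: emeasure_disc)
    moreover have "(\<lambda>\<xi>. of_real (indicator (disc 0 n) \<xi>)) = (\<lambda>\<xi>. indicator (disc 0 n) \<xi> :: complex)"
      by (auto split: split_indicator)
    ultimately show ?thesis by simp
  qed
  have [measurable]: "H \<in> borel_measurable (borel \<Otimes>\<^sub>M borel)"
    unfolding H_def by measurable
  \<comment> \<open>Absolute integrability for Fubini: the character has norm 1, so the cutoff to a
    disc of finite measure provides the integrable majorant.\<close>
  have int: "integrable ((\<mu> \<Otimes>\<^sub>M \<mu>) \<Otimes>\<^sub>M \<mu>)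
      (\<lambda>(p, \<xi>). H p * (indicator (disc 0 n) \<xi> * cnj (\<psi> (\<xi> * (fst p - snd p)))))"
  proof (rule Bochner_Integration.integrable_bound[OF P.integrable_fst_mult_snd(1)[OF H D]])
    show "AE x in (\<mu> \<Otimes>\<^sub>M \<mu>) \<Otimes>\<^sub>M \<mu>. norm (case x of (p, \<xi>) \<Rightarrow> H p * (indicator (disc 0 n) \<xi> * cnj (\<psi> (\<xi> * (fst p - snd p)))))
      \<le> norm (H (fst x) * indicator (disc 0 n) (snd x))"
      by (intro AE_I2) (auto simp: norm_mult character_norm)
  qed measurable
  have *: "fourier_integral \<mu> \<psi> h \<xi> * cnj (fourier_integral \<mu> \<psi> h \<xi>)
      = (\<integral>p. H p * cnj (\<psi> (\<xi> * (fst p - snd p))) \<partial>(\<mu> \<Otimes>\<^sub>M \<mu>))" for \<xi>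
  proof -
    have "fourier_integral \<mu> \<psi> h \<xi> * cnj (fourier_integral \<mu> \<psi> h \<xi>)
      = (\<integral>x. h x * cnj (\<psi> (\<xi> * x)) \<partial>\<mu>) * (\<integral>x. cnj (h x * cnj (\<psi> (\<xi> * x))) \<partial>\<mu>)"
      using Bochner_Integration.integral_cnj[of \<mu> "\<lambda>x. h x * cnj (\<psi> (\<xi> * x))"] by (simp only: fourier_integral_def)
    also have "\<dots> = (\<integral>p. (h (fst p) * cnj (\<psi> (\<xi> * fst p))) * cnj (h (snd p) * cnj (\<psi> (\<xi> * snd p))) \<partial>(\<mu> \<Otimes>\<^sub>M \<mu>))"
      using integrable_mult_character[OF h, of \<xi>]
      by (intro haar_pair.integrable_fst_mult_snd(2)[symmetric]) (simp_all only: integrable_cnj)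
    also have "\<dots> = (\<integral>p. H p * cnj (\<psi> (\<xi> * (fst p - snd p))) \<partial>(\<mu> \<Otimes>\<^sub>M \<mu>))"
    proof (rule Bochner_Integration.integral_cong)
      fix p :: "'a \<times> 'a"
      have "\<psi> (\<xi> * (fst p - snd p)) = \<psi> (\<xi> * fst p) * cnj (\<psi> (\<xi> * snd p))"
        using character_add[of "\<xi> * fst p" "- (\<xi> * snd p)"] by (simp add: right_diff_distrib character_minus)
      then show "(h (fst p) * cnj (\<psi> (\<xi> * fst p))) * cnj (h (snd p) * cnj (\<psi> (\<xi> * snd p)))
          = H p * cnj (\<psi> (\<xi> * (fst p - snd p)))"
        by (simp add: H_def)
    qed simp
    finally show ?thesis .
  qed
  have "(\<integral>\<xi>. indicator (disc 0 n) \<xi> * (fourier_integral \<mu> \<psi> h \<xi> * cnj (fourier_integral \<mu> \<psi> h \<xi>)) \<partial>\<mu>)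
      = (\<integral>\<xi>. (\<integral>p. H p * (indicator (disc 0 n) \<xi> * cnj (\<psi> (\<xi> * (fst p - snd p)))) \<partial>(\<mu> \<Otimes>\<^sub>M \<mu>)) \<partial>\<mu>)"
    unfolding * by (simp add: mult.left_commute flip: integral_mult_right_zero)
  also have "\<dots> = (\<integral>p. (\<integral>\<xi>. H p * (indicator (disc 0 n) \<xi> * cnj (\<psi> (\<xi> * (fst p - snd p)))) \<partial>\<mu>) \<partial>(\<mu> \<Otimes>\<^sub>M \<mu>))"
    by (rule P.Fubini_integral[OF int])
  also have "\<dots> = (\<integral>p. of_real (disc_kernel n p) * (h (fst p) * cnj (h (snd p))) \<partial>(\<mu> \<Otimes>\<^sub>M \<mu>))"
    unfolding integral_mult_right_zero integral_character_disc H_def disc_kernel_def by (simp add: mult.commute)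
  finally show ?thesis .
qed

text \<open>Polarization of the kernel formula, using that both marginals of the kernel are
  \<open>\<mu>\<close>. The computation is done in the reals, where the difference term can be
  subtracted, and is stated additively in \<open>ennreal\<close>.\<close>

lemma energy_fourier_disc:
  assumes h: "integrable \<mu> h" and h2: "square_integrable \<mu> h"
  shows "2 * energy \<mu> (disc 0 n) (fourier_integral \<mu> \<psi> h) + modulus n h = 2 * energy \<mu> UNIV h"
proof -
  have [measurable]: "h \<in> borel_measurable borel"
    using borel_measurable_integrable[OF h] by simp
  define N where "N = (\<integral>x. (norm (h x))\<^sup>2 \<partial>\<mu>)"
  define I where "I = (\<integral>\<xi>. (norm (fourier_integral \<mu> \<psi> h \<xi>))\<^sup>2 * indicator (disc 0 n) \<xi> \<partial>\<mu>)"
  define D where "D = (\<integral>p. disc_kernel n p * (norm (h (fst p) - h (snd p)))\<^sup>2 \<partial>(\<mu> \<Otimes>\<^sub>M \<mu>))"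
  have "0 \<le> N" "0 \<le> I" "0 \<le> D"
    by (simp_all add: N_def I_def D_def disc_kernel_nonneg)
  have eN: "energy \<mu> UNIV h = ennreal N"
    using energy_eq_integral(1)[OF h2, of UNIV] by (simp add: N_def)
  have "(\<integral>\<^sup>+x. ennreal ((norm (h x))\<^sup>2) \<partial>\<mu>) = ennreal N"
    using eN by (simp add: energy_def)
  then have fst: "has_bochner_integral (\<mu> \<Otimes>\<^sub>M \<mu>) (\<lambda>p. disc_kernel n p * (norm (h (fst p)))\<^sup>2) N"
    and snd: "has_bochner_integral (\<mu> \<Otimes>\<^sub>M \<mu>) (\<lambda>p. disc_kernel n p * (norm (h (snd p)))\<^sup>2) N"
    using nn_integral_disc_kernel_marginal[of "\<lambda>x. ennreal ((norm (h x))\<^sup>2)" n] \<open>0 \<le> N\<close>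
    by (auto intro!: has_bochner_integral_nn_integral simp: disc_kernel_nonneg ennreal_mult)
  have int: "integrable (\<mu> \<Otimes>\<^sub>M \<mu>) (\<lambda>p. disc_kernel n p * (norm (h (fst p) - h (snd p)))\<^sup>2)"
  proof (rule Bochner_Integration.integrable_bound)
    show "integrable (\<mu> \<Otimes>\<^sub>M \<mu>) (\<lambda>p. 2 * (disc_kernel n p * (norm (h (fst p)))\<^sup>2) + 2 * (disc_kernel n p * (norm (h (snd p)))\<^sup>2))"
      using fst snd by (auto simp: has_bochner_integral_iff)
    show "AE p in \<mu> \<Otimes>\<^sub>M \<mu>. norm (disc_kernel n p * (norm (h (fst p) - h (snd p)))\<^sup>2)
        \<le> norm (2 * (disc_kernel n p * (norm (h (fst p)))\<^sup>2) + 2 * (disc_kernel n p * (norm (h (snd p)))\<^sup>2))"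
    proof (intro AE_I2)
      fix p
      have "disc_kernel n p * (norm (h (fst p) - h (snd p)))\<^sup>2 \<le> disc_kernel n p * (2 * (norm (h (fst p)))\<^sup>2 + 2 * (norm (h (snd p)))\<^sup>2)"
        using norm_add_power2_le[of 1 "h (fst p)" "- h (snd p)"] disc_kernel_nonneg[of n p]
        by (intro mult_left_mono) auto
      then show "norm (disc_kernel n p * (norm (h (fst p) - h (snd p)))\<^sup>2)
        \<le> norm (2 * (disc_kernel n p * (norm (h (fst p)))\<^sup>2) + 2 * (disc_kernel n p * (norm (h (snd p)))\<^sup>2))"
        using disc_kernel_nonneg[of n p] by (simp add: algebra_simps)
    qed
  qed measurable
  have "of_real I = (\<integral>\<xi>. indicator (disc 0 n) \<xi> * (fourier_integral \<mu> \<psi> h \<xi> * cnj (fourier_integral \<mu> \<psi> h \<xi>)) \<partial>\<mu>)"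
    unfolding I_def integral_complex_of_real[symmetric]
    by (intro Bochner_Integration.integral_cong) (auto simp: complex_norm_square[symmetric] split: split_indicator)
  also have "\<dots> = (\<integral>p. of_real (disc_kernel n p) * (h (fst p) * cnj (h (snd p))) \<partial>(\<mu> \<Otimes>\<^sub>M \<mu>))"
    by (rule integral_fourier_disc[OF h])
  finally have I_eq: "of_real I = (\<integral>p. of_real (disc_kernel n p) * (h (fst p) * cnj (h (snd p))) \<partial>(\<mu> \<Otimes>\<^sub>M \<mu>))" .
  \<comment> \<open>The identity \<open>2 * Re (a * cnj b) = (norm a)\<^sup>2 + (norm b)\<^sup>2 -
    (norm (a - b))\<^sup>2\<close>, weighted by the kernel.\<close>
  have Re_eq: "2 * Re (of_real (disc_kernel n p) * (h (fst p) * cnj (h (snd p))))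
      = disc_kernel n p * (norm (h (fst p)))\<^sup>2 + disc_kernel n p * (norm (h (snd p)))\<^sup>2 - disc_kernel n p * (norm (h (fst p) - h (snd p)))\<^sup>2" for p
    by (simp add: cmod_power2) (simp add: power2_eq_square algebra_simps)
  have intc: "integrable (\<mu> \<Otimes>\<^sub>M \<mu>) (\<lambda>p. of_real (disc_kernel n p) * (h (fst p) * cnj (h (snd p))))"
  proof (rule Bochner_Integration.integrable_bound)
    have "integrable (\<mu> \<Otimes>\<^sub>M \<mu>) (\<lambda>p. h (fst p) * cnj (h (snd p)))"
      using h by (intro haar_pair.integrable_fst_mult_snd) simp_all
    then show "integrable (\<mu> \<Otimes>\<^sub>M \<mu>) (\<lambda>p. of_real (real q powi n) * (h (fst p) * cnj (h (snd p))))"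
      by simp
    show "AE p in \<mu> \<Otimes>\<^sub>M \<mu>. norm (of_real (disc_kernel n p) * (h (fst p) * cnj (h (snd p))))
        \<le> norm (of_real (real q powi n) * (h (fst p) * cnj (h (snd p))))"
      using q_powi_pos[of n]
      by (intro AE_I2) (simp add: norm_mult disc_kernel_def mult_right_mono split: split_indicator)
  qed measurable
  have "2 * I = 2 * Re (of_real I)" by simp
  also have "\<dots> = (\<integral>p. 2 * Re (of_real (disc_kernel n p) * (h (fst p) * cnj (h (snd p)))) \<partial>(\<mu> \<Otimes>\<^sub>M \<mu>))"
    unfolding I_eq using integral_Re[OF intc] by simp
  also have "\<dots> = N + N - D"
    unfolding Re_eq using fst snd int by (simp add: has_bochner_integral_iff D_def)
  finally have "2 * I + D = 2 * N" by simp
  moreover have "modulus n h = ennreal D"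
    unfolding modulus_def D_def using disc_kernel_nonneg
    by (intro nn_integral_eq_integral[OF int] AE_I2) simp
  moreover have "energy \<mu> (disc 0 n) (fourier_integral \<mu> \<psi> h) = ennreal I"
  proof -
    have "integrable \<mu> (\<lambda>\<xi>. (norm (fourier_integral \<mu> \<psi> h \<xi>))\<^sup>2 * indicator (disc 0 n) \<xi>)"
    proof (rule Bochner_Integration.integrable_bound)
      show "integrable \<mu> (\<lambda>\<xi>. (\<integral>x. norm (h x) \<partial>\<mu>)\<^sup>2 * indicator (disc 0 n) \<xi>)"
        by (intro integrable_mult_right integrable_real_indicator) (simp_all add: emeasure_disc)
      show "AE \<xi> in \<mu>. norm ((norm (fourier_integral \<mu> \<psi> h \<xi>))\<^sup>2 * indicator (disc 0 n) \<xi>)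
          \<le> norm ((\<integral>x. norm (h x) \<partial>\<mu>)\<^sup>2 * indicator (disc 0 n) \<xi>)"
        using norm_fourier_integral_le[of h]
        by (intro AE_I2) (auto intro!: power_mono split: split_indicator)
    qed measurable
    then show ?thesis
      unfolding I_def energy_def
      by (subst nn_integral_eq_integral[symmetric])
        (auto intro!: nn_integral_cong split: split_indicator)
  qed
  ultimately show ?thesis
    using \<open>0 \<le> N\<close> \<open>0 \<le> I\<close> \<open>0 \<le> D\<close>
    by (simp add: eN ennreal_plus[symmetric] ennreal_mult'' [symmetric] ennreal_numeral[symmetric] ennreal_mult[symmetric] del: ennreal_plus ennreal_numeral)
qed

section \<open>Averaged continuity of translations in mean square\<close>

lemma modulus_add_le:
  assumes [measurable]: "h \<in> borel_measurable borel" "k \<in> borel_measurable borel"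
  shows "modulus n (\<lambda>x. h x + k x) \<le> 2 * modulus n h + 2 * modulus n k"
proof -
  have "modulus n (\<lambda>x. h x + k x) \<le> (\<integral>\<^sup>+p. 2 * ennreal (disc_kernel n p * (norm (h (fst p) - h (snd p)))\<^sup>2)
      + 2 * ennreal (disc_kernel n p * (norm (k (fst p) - k (snd p)))\<^sup>2) \<partial>(\<mu> \<Otimes>\<^sub>M \<mu>))"
    unfolding modulus_def
  proof (rule nn_integral_mono)
    fix p
    have "disc_kernel n p * (norm ((h (fst p) + k (fst p)) - (h (snd p) + k (snd p))))\<^sup>2
      \<le> disc_kernel n p * (2 * (norm (h (fst p) - h (snd p)))\<^sup>2 + 2 * (norm (k (fst p) - k (snd p)))\<^sup>2)"
      using norm_add_power2_le[of 1 "h (fst p) - h (snd p)" "k (fst p) - k (snd p)"] disc_kernel_nonneg[of n p]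
      by (intro mult_left_mono) (auto simp: algebra_simps)
    also have "\<dots> = 2 * (disc_kernel n p * (norm (h (fst p) - h (snd p)))\<^sup>2) + 2 * (disc_kernel n p * (norm (k (fst p) - k (snd p)))\<^sup>2)"
      by (simp add: algebra_simps)
    finally show "ennreal (disc_kernel n p * (norm ((h (fst p) + k (fst p)) - (h (snd p) + k (snd p))))\<^sup>2)
      \<le> 2 * ennreal (disc_kernel n p * (norm (h (fst p) - h (snd p)))\<^sup>2)
      + 2 * ennreal (disc_kernel n p * (norm (k (fst p) - k (snd p)))\<^sup>2)"
      using disc_kernel_nonneg[of n p]
      by (simp add: ennreal_plus[symmetric] ennreal_numeral[symmetric] ennreal_mult[symmetric] ennreal_leI
          del: ennreal_plus ennreal_numeral)
  qed
  then show ?thesis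
    by (simp add: modulus_def nn_integral_add nn_integral_cmult)
qed

text \<open>The bound is uniform in \<open>n\<close>; this is what lets vanishing of the modulus
  pass to mean-square limits.\<close>

lemma modulus_le_energy:
  assumes [measurable]: "h \<in> borel_measurable borel"
  shows "modulus n h \<le> 4 * energy \<mu> UNIV h"
proof -
  have "modulus n h \<le> (\<integral>\<^sup>+p. 2 * (ennreal (disc_kernel n p) * ennreal ((norm (h (fst p)))\<^sup>2))
      + 2 * (ennreal (disc_kernel n p) * ennreal ((norm (h (snd p)))\<^sup>2)) \<partial>(\<mu> \<Otimes>\<^sub>M \<mu>))"
    unfolding modulus_def
  proof (rule nn_integral_mono)
    fix p
    have "disc_kernel n p * (norm (h (fst p) - h (snd p)))\<^sup>2 \<le> disc_kernel n p * (2 * (norm (h (fst p)))\<^sup>2 + 2 * (norm (h (snd p)))\<^sup>2)"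
      using norm_add_power2_le[of 1 "h (fst p)" "- h (snd p)"] disc_kernel_nonneg[of n p]
      by (intro mult_left_mono) auto
    also have "\<dots> = 2 * (disc_kernel n p * (norm (h (fst p)))\<^sup>2) + 2 * (disc_kernel n p * (norm (h (snd p)))\<^sup>2)"
      by (simp add: algebra_simps)
    finally show "ennreal (disc_kernel n p * (norm (h (fst p) - h (snd p)))\<^sup>2)
      \<le> 2 * (ennreal (disc_kernel n p) * ennreal ((norm (h (fst p)))\<^sup>2))
      + 2 * (ennreal (disc_kernel n p) * ennreal ((norm (h (snd p)))\<^sup>2))"
      using disc_kernel_nonneg[of n p]
      by (simp add: ennreal_plus[symmetric] ennreal_numeral[symmetric] ennreal_mult[symmetric] ennreal_leI
          del: ennreal_plus ennreal_numeral)
  qed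
  also have "\<dots> = 2 * energy \<mu> UNIV h + 2 * energy \<mu> UNIV h"
    using nn_integral_disc_kernel_marginal[of "\<lambda>x. ennreal ((norm (h x))\<^sup>2)" n]
    by (simp add: nn_integral_add nn_integral_cmult energy_def)
  also have "\<dots> = 4 * energy \<mu> UNIV h"
    by (simp add: distrib_right[symmetric])
  finally show ?thesis .
qed

lemma modulus_scale:
  assumes [measurable]: "h \<in> borel_measurable borel"
  shows "modulus n (\<lambda>x. c * h x) = ennreal ((norm c)\<^sup>2) * modulus n h"
  unfolding modulus_def
  by (subst nn_integral_cmult[symmetric])
    (auto intro!: nn_integral_cong simp: ennreal_mult[symmetric] disc_kernel_nonneg norm_mult power_mult_distrib
      right_diff_distrib[symmetric] mult_ac)

text \<open>Where the kernel is nonzero, both coordinates lie in a common disc of exponent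
  \<open>- n\<close>, hence of exponent \<open>k\<close>, so \<open>disc a k\<close> contains both
  or neither.\<close>

lemma modulus_disc:
  assumes "- n \<le> k"
  shows "modulus n (indicator (disc a k)) = 0"
proof -
  have "disc_kernel n p * (norm (indicator (disc a k) (fst p) - indicator (disc a k) (snd p) :: complex))\<^sup>2 = 0" for p
  proof (cases "fst p - snd p \<in> disc 0 (- n)")
    case True
    then have "fst p \<in> disc (snd p) (- n)"
      by (simp add: disc_def)
    then have "fst p \<in> disc (snd p) k"
      using disc_mono[OF assms] by blast
    then have "disc (fst p) k = disc (snd p) k"
      by (rule disc_eq)
    then have "fst p \<in> disc a k \<longleftrightarrow> snd p \<in> disc a k"
      using mem_disc_commute by blast
    then show ?thesis
      by (simp add: indicator_def)
  qed (simp add: disc_kernel_def)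
  then show ?thesis
    unfolding modulus_def by (simp only: ennreal_0 nn_integral_const mult_zero_left)
qed

text \<open>A predicate stable under linear combinations and mean-square limits. It is carried from
  discs to bounded Borel sets, then to simple functions with bounded support, then to all
  square-integrable functions.\<close>

definition translation_continuous :: "('a \<Rightarrow> complex) \<Rightarrow> bool"
  where "translation_continuous h \<longleftrightarrow> h \<in> borel_measurable borel \<and> (\<lambda>n. modulus (int n) h) \<longlonglongrightarrow> 0"

lemma translation_continuous_add:
  assumes "translation_continuous h" "translation_continuous k"
  shows "translation_continuous (\<lambda>x. h x + k x)"
proof -
  have [measurable]: "h \<in> borel_measurable borel" "k \<in> borel_measurable borel"
    and lim: "(\<lambda>n. modulus (int n) h) \<longlonglongrightarrow> 0" "(\<lambda>n. modulus (int n) k) \<longlonglongrightarrow> 0"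
    using assms by (auto simp: translation_continuous_def)
  have "(\<lambda>n. 2 * modulus (int n) h + 2 * modulus (int n) k) \<longlonglongrightarrow> 2 * 0 + 2 * 0"
    by (intro tendsto_add ennreal_tendsto_cmult lim) simp_all
  then have "(\<lambda>n. 2 * modulus (int n) h + 2 * modulus (int n) k) \<longlonglongrightarrow> 0"
    by simp
  then have "(\<lambda>n. modulus (int n) (\<lambda>x. h x + k x)) \<longlonglongrightarrow> 0"
    by (rule ennreal_tendsto_0_le[OF _ modulus_add_le]) simp_all
  then show ?thesis
    by (simp add: translation_continuous_def)
qed

lemma translation_continuous_scale:
  assumes "translation_continuous h"
  shows "translation_continuous (\<lambda>x. c * h x)"
proof -
  have [measurable]: "h \<in> borel_measurable borel"
    and lim: "(\<lambda>n. modulus (int n) h) \<longlonglongrightarrow> 0"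
    using assms by (auto simp: translation_continuous_def)
  have "(\<lambda>n. ennreal ((norm c)\<^sup>2) * modulus (int n) h) \<longlonglongrightarrow> ennreal ((norm c)\<^sup>2) * 0"
    by (intro ennreal_tendsto_cmult lim) simp_all
  then show ?thesis
    by (simp add: translation_continuous_def modulus_scale)
qed

lemma translation_continuous_disc: "translation_continuous (indicator (disc a k))"
proof -
  have "\<forall>\<^sub>F n in sequentially. modulus (int n) (indicator (disc a k)) = 0"
    using modulus_disc by (intro eventually_sequentiallyI[of "nat (- k)"]) auto
  then show ?thesis
    by (auto simp: translation_continuous_def intro: tendsto_eventually)
qed

lemma translation_continuous_0: "translation_continuous (\<lambda>x. 0)"
  by (simp add: translation_continuous_def modulus_def)

lemma translation_continuous_sum:
  assumes "\<And>i. i \<in> I \<Longrightarrow> translation_continuous (h i)"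
  shows "translation_continuous (\<lambda>x. \<Sum>i\<in>I. h i x)"
  using assms
  by (induction I rule: infinite_finite_induct)
    (simp_all add: translation_continuous_0 translation_continuous_add)

lemma translation_continuous_limit:
  assumes [measurable]: "h \<in> borel_measurable borel"
    and k: "\<And>i. translation_continuous (k i)"
    and lim: "(\<lambda>i. energy \<mu> UNIV (\<lambda>x. h x - k i x)) \<longlonglongrightarrow> 0"
  shows "translation_continuous h"
proof -
  have [measurable]: "k i \<in> borel_measurable borel" for i
    using k by (simp add: translation_continuous_def)
  \<comment> \<open>The limit in \<open>n\<close> is taken with \<open>i\<close> fixed, since the
    moduli of the approximants need not vanish uniformly in \<open>i\<close>. The constant 8 is 2
    from \<open>modulus_add_le\<close> times 4 from \<open>modulus_le_energy\<close>.\<close>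
  have "limsup (\<lambda>n. modulus (int n) h) \<le> 8 * energy \<mu> UNIV (\<lambda>x. h x - k i x)" for i
  proof -
    let ?E = "energy \<mu> UNIV (\<lambda>x. h x - k i x)"
    have "modulus (int n) h \<le> 2 * modulus (int n) (k i) + 8 * ?E" for n
    proof -
      have "modulus (int n) h = modulus (int n) (\<lambda>x. k i x + (h x - k i x))"
        by simp
      also have "\<dots> \<le> 2 * modulus (int n) (k i) + 2 * modulus (int n) (\<lambda>x. h x - k i x)"
        by (rule modulus_add_le) measurable
      also have "\<dots> \<le> 2 * modulus (int n) (k i) + 2 * (4 * ?E)"
        by (intro add_left_mono mult_left_mono modulus_le_energy) simp_all
      finally show ?thesis
        by (simp add: mult.assoc[symmetric])
    qed
    then have "limsup (\<lambda>n. modulus (int n) h) \<le> limsup (\<lambda>n. 2 * modulus (int n) (k i) + 8 * ?E)"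
      by (intro Limsup_mono always_eventually) simp
    also have "\<dots> = 2 * 0 + 8 * ?E"
      using k[of i]
      by (intro lim_imp_Limsup sequentially_bot tendsto_add tendsto_const ennreal_tendsto_cmult)
        (auto simp: translation_continuous_def)
    finally show ?thesis by simp
  qed
  moreover have "(\<lambda>i. 8 * energy \<mu> UNIV (\<lambda>x. h x - k i x)) \<longlonglongrightarrow> 8 * 0"
    by (intro ennreal_tendsto_cmult lim) simp
  ultimately have "limsup (\<lambda>n. modulus (int n) h) \<le> 8 * 0"
    by (intro LIMSEQ_le_const) auto
  then have "limsup (\<lambda>n. modulus (int n) h) = 0"
    by simp
  then have "(\<lambda>n. modulus (int n) h) \<longlonglongrightarrow> 0"
    using Liminf_le_Limsup[OF sequentially_bot, of "\<lambda>n. modulus (int n) h"]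
    by (intro Liminf_eq_Limsup) auto
  then show ?thesis
    by (simp add: translation_continuous_def)
qed

lemma square_integrable_measurable: "square_integrable \<mu> h \<Longrightarrow> h \<in> borel_measurable borel"
  using measurable_cong_sets[OF sets_haar refl, of borel] by (auto simp: square_integrable_def)

lemma translation_continuous_empty: "translation_continuous (indicator {})"
  by (simp add: translation_continuous_def modulus_def)

text \<open>Dynkin induction over the intersection-stable generator of discs. Cutting with the fixed
  \<open>disc 0 k\<close> keeps all measures finite: complements become differences from that disc,
  and partial unions converge in mean square by domination.\<close>

lemma translation_continuous_borel:
  assumes "A \<in> sets borel"
  shows "translation_continuous (indicator (A \<inter> disc 0 k))"
proof (rule sigma_sets_induct_disjoint[OF Int_stable_discs _ assms[unfolded borel_eq_sigma_discs],
      where P = "\<lambda>A. translation_continuous (indicator (A \<inter> disc 0 k))"])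
  fix A assume "A \<in> insert {} (range (\<lambda>(a, k). disc a k))"
  moreover have "disc a j \<inter> disc 0 k \<in> insert {} (range (\<lambda>(a, k). disc a k))" for a j
    using Int_stable_discs unfolding Int_stable_def by blast
  ultimately have "A \<inter> disc 0 k \<in> insert {} (range (\<lambda>(a, k). disc a k))"
    by auto
  then show "translation_continuous (indicator (A \<inter> disc 0 k))"
    using translation_continuous_disc translation_continuous_empty by auto
next
  show "translation_continuous (indicator ({} \<inter> disc 0 k))"
    using translation_continuous_empty by simp
next
  fix A assume "translation_continuous (indicator (A \<inter> disc 0 k))"
  then have "translation_continuous (\<lambda>x. indicator (disc 0 k) x + (- 1) * indicator (A \<inter> disc 0 k) x)"
    by (intro translation_continuous_add translation_continuous_scale translation_continuous_disc)
  moreover have "(\<lambda>x. indicator (disc 0 k) x + (- 1) * indicator (A \<inter> disc 0 k) x)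
      = (indicator ((UNIV - A) \<inter> disc 0 k) :: 'a \<Rightarrow> complex)"
    by (auto simp: indicator_def)
  ultimately show "translation_continuous (indicator ((UNIV - A) \<inter> disc 0 k))"
    by simp
next
  fix A :: "nat \<Rightarrow> 'a set"
  assume disj: "disjoint_family A"
    and "range A \<subseteq> sigma_sets UNIV (insert {} (range (\<lambda>(a, k). disc a k)))"
    and A: "\<And>i. translation_continuous (indicator (A i \<inter> disc 0 k))"
  then have [measurable]: "A i \<in> sets borel" for i
    by (auto simp: borel_eq_sigma_discs)
  define U where "U = (\<Union>i. A i)"
  have U [measurable]: "U \<in> sets borel"
    unfolding U_def by measurable
  show "translation_continuous (indicator ((\<Union>i. A i) \<inter> disc 0 k))"
    unfolding U_def[symmetric]
  proof (rule translation_continuous_limit)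
    show "translation_continuous (\<lambda>x. \<Sum>j<i. indicator (A j \<inter> disc 0 k) x)" for i
      using A by (intro translation_continuous_sum) simp
    have eq: "(\<Sum>j<i. indicator (A j \<inter> disc 0 k) x) = (indicator ((\<Union>j<i. A j) \<inter> disc 0 k) x :: complex)" for i x
    proof -
      have "(\<Sum>j<i. indicator (A j) x) = (indicator (\<Union>j<i. A j) x :: complex)"
        using disj by (intro indicator_UN_disjoint[symmetric]) (auto intro: disjoint_family_on_mono)
      then show ?thesis
        by (simp add: indicator_inter_arith sum_distrib_right[symmetric])
    qed
    have "(\<lambda>i. \<integral>\<^sup>+x\<in>UNIV. ennreal ((norm (indicator (U \<inter> disc 0 k) x - (indicator ((\<Union>j<i. A j) \<inter> disc 0 k) x :: complex)))\<^sup>2) \<partial>\<mu>)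
        \<longlonglongrightarrow> (\<integral>\<^sup>+x. 0 \<partial>\<mu>)"
    proof (rule nn_integral_dominated_convergence[where w="indicator (disc 0 k)"])
      show "AE x in \<mu>. ennreal ((norm (indicator (U \<inter> disc 0 k) x - (indicator ((\<Union>j<i. A j) \<inter> disc 0 k) x :: complex)))\<^sup>2) * indicator UNIV x
          \<le> indicator (disc 0 k) x" for i
        by (intro AE_I2) (auto simp: indicator_def)
      show "AE x in \<mu>. (\<lambda>i. ennreal ((norm (indicator (U \<inter> disc 0 k) x - (indicator ((\<Union>j<i. A j) \<inter> disc 0 k) x :: complex)))\<^sup>2) * indicator UNIV x)
          \<longlonglongrightarrow> 0"
      proof (intro AE_I2 tendsto_eventually)
        fix x
        have "\<exists>i0. \<forall>i\<ge>i0. x \<in> U \<longleftrightarrow> x \<in> (\<Union>j<i. A j)"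
        proof (cases "x \<in> U")
          case True
          then obtain j where "x \<in> A j" by (auto simp: U_def)
          then show ?thesis using True by (intro exI[of _ "Suc j"]) auto
        qed (auto simp: U_def)
        then obtain i0 where i0: "\<And>i. i \<ge> i0 \<Longrightarrow> x \<in> U \<longleftrightarrow> x \<in> (\<Union>j<i. A j)" by blast
        show "\<forall>\<^sub>F i in sequentially. ennreal ((norm (indicator (U \<inter> disc 0 k) x - (indicator ((\<Union>j<i. A j) \<inter> disc 0 k) x :: complex)))\<^sup>2) * indicator UNIV x = 0"
        proof (rule eventually_sequentiallyI[of i0])
          fix i assume "i0 \<le> i"
          then have "indicator (U \<inter> disc 0 k) x = (indicator ((\<Union>j<i. A j) \<inter> disc 0 k) x :: complex)"
            using i0[of i] by (simp add: indicator_def)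
          then show "ennreal ((norm (indicator (U \<inter> disc 0 k) x - (indicator ((\<Union>j<i. A j) \<inter> disc 0 k) x :: complex)))\<^sup>2) * indicator UNIV x = 0"
            by simp
        qed
      qed
    qed (auto simp: emeasure_disc)
    then show "(\<lambda>i. energy \<mu> UNIV (\<lambda>x. indicator (U \<inter> disc 0 k) x - (\<Sum>j<i. indicator (A j \<inter> disc 0 k) x))) \<longlonglongrightarrow> 0"
      unfolding energy_def eq by simp
  qed measurable
qed auto

lemma translation_continuous_square_integrable:
  assumes h: "square_integrable \<mu> h"
  shows "translation_continuous h"
proof -
  have [measurable]: "h \<in> borel_measurable borel"
    using h by (rule square_integrable_measurable)
  have "h \<in> borel_measurable \<mu>" by simp
  then obtain s where s: "\<And>i. simple_function \<mu> (s i)"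
    and lim: "\<And>x. (\<lambda>i. s i x) \<longlonglongrightarrow> h x"
    and bound: "\<And>i x. dist (s i x) 0 \<le> 2 * dist (h x) 0"
    using borel_measurable_implies_sequence_metric[of h \<mu> 0] by auto
  have s_meas: "s i -` {y} \<in> sets borel" for i y
    using simple_functionD(2)[OF s[of i], of "{y}"] by simp
  have [measurable]: "s i \<in> borel_measurable borel" for i
    using borel_measurable_simple_function[OF s[of i]] by simp
  \<comment> \<open>The simple approximants are cut off by growing discs, so that only indicators of
    Borel sets inside a disc occur.\<close>
  define k where "k i x = s i x * indicator (disc 0 (int i)) x" for i x
  show ?thesis
  proof (rule translation_continuous_limit)
    show "translation_continuous (k i)" for i
    proof -
      have "s i x = (\<Sum>y\<in>range (s i). y * indicator (s i -` {y}) x)" for x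
      proof -
        have "finite (range (s i))"
          using simple_functionD(1)[OF s[of i]] by simp
        then have "(\<Sum>y\<in>range (s i). if y = s i x then s i x else 0) = s i x"
          by (subst sum.delta) simp_all
        moreover have "y * indicator (s i -` {y}) x = (if y = s i x then s i x else 0)" for y
          by simp
        ultimately show ?thesis by simp
      qed
      then have "k i x = (\<Sum>y\<in>range (s i). y * indicator (s i -` {y}) x) * indicator (disc 0 (int i)) x" for x
        unfolding k_def by (rule arg_cong)
      then have "k i = (\<lambda>x. \<Sum>y\<in>range (s i). y * indicator (s i -` {y} \<inter> disc 0 (int i)) x)"
        by (simp only: fun_eq_iff indicator_inter_arith sum_distrib_right mult.assoc) simp
      then show ?thesis
        by (simp only:) (intro translation_continuous_sum translation_continuous_scale translation_continuous_borel s_meas)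
    qed
    have "(\<lambda>i. \<integral>\<^sup>+x\<in>UNIV. ennreal ((norm (h x - k i x))\<^sup>2) \<partial>\<mu>) \<longlonglongrightarrow> (\<integral>\<^sup>+x. 0 \<partial>\<mu>)"
    \<comment> \<open>The approximants satisfy \<open>norm (s i x) \<le> 2 * norm (h x)\<close>, so
      the difference is at most three times \<open>norm (h x)\<close>; the factor 9 is its
      square.\<close>
    proof (rule nn_integral_dominated_convergence[where w="\<lambda>x. ennreal (9 * (norm (h x))\<^sup>2)"])
      show "AE x in \<mu>. ennreal ((norm (h x - k i x))\<^sup>2) * indicator UNIV x \<le> ennreal (9 * (norm (h x))\<^sup>2)" for i
      proof (intro AE_I2)
        fix x
        have "norm (k i x) \<le> 2 * norm (h x)"
          using bound[of i x] by (simp add: k_def norm_mult split: split_indicator)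
        then have "norm (h x - k i x) \<le> 3 * norm (h x)"
          using norm_triangle_ineq4[of "h x" "k i x"] by simp
        then have "(norm (h x - k i x))\<^sup>2 \<le> (3 * norm (h x))\<^sup>2"
          by (intro power_mono) simp_all
        then show "ennreal ((norm (h x - k i x))\<^sup>2) * indicator UNIV x \<le> ennreal (9 * (norm (h x))\<^sup>2)"
          by (simp add: power_mult_distrib ennreal_leI)
      qed
      show "AE x in \<mu>. (\<lambda>i. ennreal ((norm (h x - k i x))\<^sup>2) * indicator UNIV x) \<longlonglongrightarrow> 0"
      proof (intro AE_I2)
        fix x
        obtain k0 where "\<And>i. i \<ge> k0 \<Longrightarrow> x \<in> disc 0 (int i)"
          using in_disc_eventually by blast
        then have "\<forall>\<^sub>F i in sequentially. s i x = k i x"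
          by (intro eventually_sequentiallyI[of k0]) (simp add: k_def)
        then have "(\<lambda>i. k i x) \<longlonglongrightarrow> h x"
          using lim by (rule Lim_transform_eventually[rotated])
        then have "(\<lambda>i. (norm (h x - k i x))\<^sup>2) \<longlonglongrightarrow> (norm (h x - h x))\<^sup>2"
          by (intro tendsto_intros)
        then have "(\<lambda>i. ennreal ((norm (h x - k i x))\<^sup>2)) \<longlonglongrightarrow> ennreal 0"
          by (intro tendsto_ennrealI) simp
        then show "(\<lambda>i. ennreal ((norm (h x - k i x))\<^sup>2) * indicator UNIV x) \<longlonglongrightarrow> 0"
          by simp
      qed
      show "(\<integral>\<^sup>+x. ennreal (9 * (norm (h x))\<^sup>2) \<partial>\<mu>) < \<infinity>"
        using h by (simp add: square_integrable_iff energy_def ennreal_mult nn_integral_cmult ennreal_mult_less_top)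
    qed (simp_all add: k_def)
    then show "(\<lambda>i. energy \<mu> UNIV (\<lambda>x. h x - k i x)) \<longlonglongrightarrow> 0"
      unfolding energy_def by simp
  qed measurable
qed

section \<open>Plancherel for integrable functions and its extension\<close>

lemma energy_disc_tendsto:
  assumes [measurable]: "u \<in> borel_measurable borel"
  shows "(\<lambda>n. energy \<mu> (disc a (int n)) u) \<longlonglongrightarrow> energy \<mu> UNIV u"
  unfolding energy_def
proof (rule nn_integral_LIMSEQ)
  show "incseq (\<lambda>n x. ennreal ((norm (u x))\<^sup>2) * indicator (disc a (int n)) x)"
    using disc_mono[of "int _" "int _" a]
    by (auto simp: incseq_def le_fun_def split: split_indicator)
  show "(\<lambda>n. ennreal ((norm (u x))\<^sup>2) * indicator (disc a (int n)) x) \<longlonglongrightarrow> ennreal ((norm (u x))\<^sup>2) * indicator UNIV x" for x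
  proof -
    obtain k0 where "\<And>i. i \<ge> k0 \<Longrightarrow> x \<in> disc a (int i)"
      using in_disc_eventually by blast
    then show ?thesis
      by (intro tendsto_eventually eventually_sequentiallyI[of k0]) simp
  qed
qed measurable

theorem energy_fourier_integral:
  assumes h: "integrable \<mu> h" and h2: "square_integrable \<mu> h"
  shows "energy \<mu> UNIV (fourier_integral \<mu> \<psi> h) = energy \<mu> UNIV h"
proof -
  have [measurable]: "h \<in> borel_measurable borel"
    using h2 by (rule square_integrable_measurable)
  have "(\<lambda>n. 2 * energy \<mu> (disc 0 (int n)) (fourier_integral \<mu> \<psi> h) + modulus (int n) h)
      \<longlonglongrightarrow> 2 * energy \<mu> UNIV (fourier_integral \<mu> \<psi> h) + 0"
    using translation_continuous_square_integrable[OF h2]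
    by (intro tendsto_add ennreal_tendsto_cmult energy_disc_tendsto)
      (simp_all add: translation_continuous_def)
  \<comment> \<open>By \<open>energy_fourier_disc\<close> the sequence is constant, equal to twice
    the energy of \<open>h\<close>, so its limit is that constant.\<close>
  then have "2 * energy \<mu> UNIV (fourier_integral \<mu> \<psi> h) = 2 * energy \<mu> UNIV h"
    unfolding energy_fourier_disc[OF h h2] by (simp add: LIMSEQ_const_iff)
  then show ?thesis
    by (simp add: ennreal_mult_cancel_left)
qed

lemma square_integrable_fourier_integral:
  assumes "integrable \<mu> h" "square_integrable \<mu> h"
  shows "square_integrable \<mu> (fourier_integral \<mu> \<psi> h)"
  using energy_fourier_integral[OF assms] assms by (simp add: square_integrable_iff)

text \<open>On a set of finite measure square-integrability gives integrability, since
  \<open>r \<le> r\<^sup>2 + 1\<close>. Thus truncations to discs are admissible for the Fourier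
  integral.\<close>

lemma integrable_on_disc:
  assumes f: "square_integrable \<mu> f"
  shows "integrable \<mu> (\<lambda>x. f x * indicator (disc a k) x)"
proof (rule Bochner_Integration.integrable_bound)
  have [measurable]: "f \<in> borel_measurable borel"
    using f by (rule square_integrable_measurable)
  show "integrable \<mu> (\<lambda>x. (norm (f x))\<^sup>2 + indicator (disc a k) x)"
    using f by (intro Bochner_Integration.integrable_add integrable_real_indicator)
      (simp_all add: square_integrable_def emeasure_disc)
  show "(\<lambda>x. f x * indicator (disc a k) x) \<in> borel_measurable \<mu>"
    by measurable
  have "r \<le> r\<^sup>2 + 1" for r :: real
    using zero_le_power2[of "r - 1 / 2"] by (simp add: power2_eq_square algebra_simps)
  then show "AE x in \<mu>. norm (f x * indicator (disc a k) x) \<le> norm ((norm (f x))\<^sup>2 + indicator (disc a k) x :: real)"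
    by (intro AE_I2) (simp split: split_indicator)
qed

lemma square_integrable_indicator:
  assumes f: "square_integrable \<mu> f" and [measurable]: "S \<in> sets borel"
  shows "square_integrable \<mu> (\<lambda>x. f x * indicator S x)"
proof (rule square_integrable_bound[OF f, of _ 1])
  have [measurable]: "f \<in> borel_measurable borel"
    using f by (rule square_integrable_measurable)
  show "(\<lambda>x. f x * indicator S x) \<in> borel_measurable \<mu>"
    by measurable
qed (simp add: norm_mult split: split_indicator)

lemma energy_indicator: "energy M T (\<lambda>x. h x * indicator S x) = energy M (S \<inter> T) h"
  unfolding energy_def by (intro nn_integral_cong) (auto split: split_indicator)

lemma tail_energy_tendsto_0:
  assumes f: "square_integrable \<mu> f"
  shows "(\<lambda>n. energy \<mu> (- disc a (int n)) f) \<longlonglongrightarrow> 0"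
proof -
  have [measurable]: "f \<in> borel_measurable borel"
    using f by (rule square_integrable_measurable)
  have fin: "energy \<mu> UNIV f < \<infinity>"
    using f by (simp add: square_integrable_iff)
  have "(\<lambda>n. energy \<mu> UNIV f - energy \<mu> (disc a (int n)) f) \<longlonglongrightarrow> energy \<mu> UNIV f - energy \<mu> UNIV f"
    using fin by (intro tendsto_diff_ennreal tendsto_const energy_disc_tendsto) auto
  moreover have "energy \<mu> UNIV f - energy \<mu> (disc a (int n)) f = energy \<mu> (- disc a (int n)) f" for n
  proof -
    have "energy \<mu> (disc a (int n)) f < \<infinity>"
      using fin energy_mono_set[of "disc a (int n)" UNIV \<mu> f] by (simp add: order.strict_trans1)
    then show ?thesis
      using energy_split[of f \<mu> "disc a (int n)"] by (simp add: ennreal_add_diff_cancel_left)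
  qed
  ultimately show ?thesis
    using fin by simp
qed

text \<open>Truncations of \<open>f\<close> to discs approximate it; their transforms form a Cauchy
  sequence because the Fourier integral preserves energy on differences, and completeness yields the
  limit. This justifies the choice in \<open>plancherel_transform\<close>.\<close>

theorem plancherel_transform_exists:
  assumes f: "square_integrable \<mu> f"
  shows "\<exists>g. square_integrable \<mu> g \<and>
     (\<exists>h. (\<forall>n. integrable \<mu> (h n) \<and> square_integrable \<mu> (h n)) \<and>
          l2_tendsto \<mu> h f \<and> l2_tendsto \<mu> (\<lambda>n. fourier_integral \<mu> \<psi> (h n)) g)"
proof -
  have [measurable]: "f \<in> borel_measurable borel"
    using f by (rule square_integrable_measurable)
  \<comment> \<open>Discs are selected so that the tails decay like \<open>(1 / 4) ^ m\<close>, the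
    rate required by \<open>riesz_fischer_geometric\<close>.\<close>
  have "\<exists>k. energy \<mu> (- disc 0 (int k)) f < ennreal ((1 / 4) ^ m)" for m
    using order_tendstoD(2)[OF tail_energy_tendsto_0[OF f, of 0], of "ennreal ((1 / 4) ^ m)"]
    by (auto simp: eventually_sequentially)
  then obtain k where k: "\<And>m. energy \<mu> (- disc 0 (int (k m))) f < ennreal ((1 / 4) ^ m)"
    by metis
  define h where "h n x = f x * indicator (disc 0 (int (k n))) x" for n x
  have h1: "integrable \<mu> (h n)" and h2: "square_integrable \<mu> (h n)" for n
    unfolding h_def by (intro integrable_on_disc square_integrable_indicator f disc_sets)+
  have [measurable]: "h n \<in> borel_measurable borel" for n
    unfolding h_def by measurable
  \<comment> \<open>At each point the difference of two truncations is 0 or plus or minus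
    \<open>f\<close>, and it is nonzero only outside one of the two discs. So the tails just add,
    and \<open>k\<close> may be non-monotone.\<close>
  have diff: "energy \<mu> UNIV (\<lambda>x. h m x - h n x) \<le> ennreal (2 * (1 / 4) ^ m)" if "m \<le> n" for m n
  proof -
    have "energy \<mu> UNIV (\<lambda>x. h m x - h n x) \<le> energy \<mu> (- disc 0 (int (k m))) f + energy \<mu> (- disc 0 (int (k n))) f"
      unfolding energy_def
      by (subst nn_integral_add[symmetric])
        (auto intro!: nn_integral_mono simp: h_def split: split_indicator)
    also have "\<dots> \<le> ennreal ((1 / 4) ^ m) + ennreal ((1 / 4) ^ n)"
      by (intro add_mono less_imp_le k)
    also have "\<dots> \<le> ennreal ((1 / 4) ^ m) + ennreal ((1 / 4) ^ m)"
      using that by (intro add_left_mono ennreal_leI power_decreasing) auto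
    also have "\<dots> = ennreal (2 * (1 / 4) ^ m)"
      by (simp add: ennreal_plus[symmetric] del: ennreal_plus)
    finally show ?thesis .
  qed
  have hf: "l2_tendsto \<mu> h f"
    unfolding l2_tendsto_def
  proof (rule ennreal_tendsto_0_le)
    have "(\<lambda>n. ennreal ((1 / 4) ^ n)) \<longlonglongrightarrow> ennreal 0"
      by (intro tendsto_ennrealI LIMSEQ_power_zero) simp
    then show "(\<lambda>n. ennreal ((1 / 4) ^ n)) \<longlonglongrightarrow> 0"
      by (simp only: ennreal_0)
    fix n
    have "(\<integral>\<^sup>+x. ennreal ((norm (h n x - f x))\<^sup>2) \<partial>\<mu>) = energy \<mu> (- disc 0 (int (k n))) f"
      unfolding energy_def h_def by (intro nn_integral_cong) (auto split: split_indicator)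
    then show "(\<integral>\<^sup>+x. ennreal ((norm (h n x - f x))\<^sup>2) \<partial>\<mu>) \<le> ennreal ((1 / 4) ^ n)"
      using k[of n] by simp
  qed
  obtain g where g: "g \<in> borel_measurable \<mu>" "l2_tendsto \<mu> (\<lambda>n. fourier_integral \<mu> \<psi> (h n)) g"
  proof (rule riesz_fischer_geometric)
    show "fourier_integral \<mu> \<psi> (h n) \<in> borel_measurable \<mu>" for n
      by measurable
    fix m n :: nat
    assume "m \<le> n"
    have "energy \<mu> UNIV (fourier_integral \<mu> \<psi> (\<lambda>x. h m x - h n x)) = energy \<mu> UNIV (\<lambda>x. h m x - h n x)"
      using h1 h2 by (intro energy_fourier_integral Bochner_Integration.integrable_diff square_integrable_diff)
    then show "(\<integral>\<^sup>+x. ennreal ((norm (fourier_integral \<mu> \<psi> (h m) x - fourier_integral \<mu> \<psi> (h n) x))\<^sup>2) \<partial>\<mu>) \<le> ennreal (2 * (1 / 4) ^ m)"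
      using diff[OF \<open>m \<le> n\<close>] by (simp add: fourier_integral_diff h1 energy_def)
  qed simp_all
  have "square_integrable \<mu> g"
    by (rule l2_tendsto_square_integrable[OF square_integrable_fourier_integral[OF h1 h2] g])
  then show ?thesis
    using g hf h1 h2 by blast
qed

section \<open>Uncertainty principle\<close>

text \<open>Cauchy-Schwarz against the indicator of \<open>disc a m\<close> bounds the squared
  transform at every point by the measure of that disc times the energy; integrating over
  \<open>disc b k\<close> contributes the second measure.\<close>

lemma energy_fourier_integral_disc_le:
  assumes h: "square_integrable \<mu> h"
  shows "energy \<mu> (disc b k) (fourier_integral \<mu> \<psi> (\<lambda>x. h x * indicator (disc a m) x))
    \<le> ennreal (real q powi (m + k)) * energy \<mu> UNIV h"
proof -
  let ?u = "\<lambda>x. h x * indicator (disc a m) x"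
  let ?F = "fourier_integral \<mu> \<psi> ?u"
  have [measurable]: "h \<in> borel_measurable borel"
    using h by (rule square_integrable_measurable)
  have u: "integrable \<mu> ?u"
    by (rule integrable_on_disc[OF h])
  have pointwise: "ennreal ((norm (?F \<xi>))\<^sup>2) \<le> ennreal (real q powi m) * energy \<mu> UNIV h" for \<xi>
  proof -
    have "ennreal (norm (?F \<xi>)) \<le> ennreal (\<integral>x. norm (?u x) \<partial>\<mu>)"
      by (intro ennreal_leI norm_fourier_integral_le)
    also have "\<dots> = (\<integral>\<^sup>+x. ennreal (norm (?u x)) \<partial>\<mu>)"
      using u by (intro nn_integral_eq_integral[symmetric]) simp_all
    also have "\<dots> = (\<integral>\<^sup>+x. ennreal (norm (h x)) * indicator (disc a m) x \<partial>\<mu>)"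
      by (intro nn_integral_cong) (simp add: norm_mult split: split_indicator)
    finally have "(ennreal (norm (?F \<xi>)))\<^sup>2 \<le> (\<integral>\<^sup>+x. ennreal (norm (h x)) * indicator (disc a m) x \<partial>\<mu>)\<^sup>2"
      by (intro power_mono) simp_all
    also have "\<dots> \<le> (\<integral>\<^sup>+x. (ennreal (norm (h x)))\<^sup>2 \<partial>\<mu>) * (\<integral>\<^sup>+x. (indicator (disc a m) x)\<^sup>2 \<partial>\<mu>)"
      by (rule Cauchy_Schwarz_nn_integral) measurable
    also have "(\<integral>\<^sup>+x. (indicator (disc a m) x)\<^sup>2 \<partial>\<mu>) = (\<integral>\<^sup>+x. indicator (disc a m) x \<partial>\<mu>)"
      by (intro nn_integral_cong) (simp split: split_indicator)
    also have "\<dots> = ennreal (real q powi m)"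
      by (simp add: emeasure_disc)
    also have "(\<integral>\<^sup>+x. (ennreal (norm (h x)))\<^sup>2 \<partial>\<mu>) = energy \<mu> UNIV h"
      by (simp add: energy_def ennreal_power)
    finally show ?thesis
      by (simp add: ennreal_power mult.commute)
  qed
  have "energy \<mu> (disc b k) ?F \<le> (\<integral>\<^sup>+\<xi>. ennreal (real q powi m) * energy \<mu> UNIV h * indicator (disc b k) \<xi> \<partial>\<mu>)"
    unfolding energy_def[of \<mu> "disc b k"] by (intro nn_integral_mono mult_right_mono pointwise) simp
  also have "\<dots> = ennreal (real q powi m) * energy \<mu> UNIV h * ennreal (real q powi k)"
    by (simp add: nn_integral_cmult emeasure_disc)
  also have "\<dots> = ennreal (real q powi (m + k)) * energy \<mu> UNIV h"
    using q_powi_pos[of m] q_powi_pos[of k] q_neq_0 ennreal_mult[of "real q powi m" "real q powi k"]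
    by (simp add: power_int_add mult_ac)
  finally show ?thesis .
qed

text \<open>Splitting with weights \<open>3 / 2\<close> and \<open>3\<close> keeps the first coefficient \<open>3 / (2 q)\<close> below \<open>1\<close> even for \<open>q = 2\<close>.\<close>

lemma fourier_concentration:
  assumes h1: "integrable \<mu> h" and h2: "square_integrable \<mu> h"
  shows "energy \<mu> (disc b k) (fourier_integral \<mu> \<psi> h)
    \<le> ennreal (3 / 2 * real q powi (m + k)) * energy \<mu> UNIV h + 3 * energy \<mu> (- disc a m) h"
proof -
  let ?u = "\<lambda>x. h x * indicator (disc a m) x" and ?v = "\<lambda>x. h x * indicator (- disc a m) x"
  have [measurable]: "h \<in> borel_measurable borel"
    using h2 by (rule square_integrable_measurable)
  have u: "integrable \<mu> ?u"
    by (rule integrable_on_disc[OF h2])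
  have "(\<lambda>x. h x - ?u x) = ?v"
    by (auto split: split_indicator)
  then have v: "integrable \<mu> ?v"
    using Bochner_Integration.integrable_diff[OF h1 u] by simp
  have v2: "square_integrable \<mu> ?v"
    by (rule square_integrable_indicator[OF h2]) measurable
  have "(\<lambda>x. ?u x + ?v x) = h"
    by (auto split: split_indicator)
  then have "energy \<mu> (disc b k) (fourier_integral \<mu> \<psi> h)
    = energy \<mu> (disc b k) (\<lambda>\<xi>. fourier_integral \<mu> \<psi> ?u \<xi> + fourier_integral \<mu> \<psi> ?v \<xi>)"
    using fourier_integral_add[OF u v] by simp
  also have "\<dots> \<le> ennreal (1 + 1 / 2) * energy \<mu> (disc b k) (fourier_integral \<mu> \<psi> ?u)
      + ennreal (1 + 1 / (1 / 2)) * energy \<mu> (disc b k) (fourier_integral \<mu> \<psi> ?v)"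
    by (rule energy_add_le) measurable
  also have "\<dots> \<le> ennreal (3 / 2) * (ennreal (real q powi (m + k)) * energy \<mu> UNIV h) + 3 * energy \<mu> (- disc a m) h"
  proof (intro add_mono mult_mono energy_fourier_integral_disc_le h2)
    have "energy \<mu> (disc b k) (fourier_integral \<mu> \<psi> ?v) \<le> energy \<mu> UNIV (fourier_integral \<mu> \<psi> ?v)"
      by (rule energy_mono_set) simp
    also have "\<dots> = energy \<mu> (- disc a m) h"
      by (simp add: energy_fourier_integral[OF v v2] energy_indicator)
    finally show "energy \<mu> (disc b k) (fourier_integral \<mu> \<psi> ?v) \<le> energy \<mu> (- disc a m) h" .
  qed simp_all
  finally show ?thesis
    using q_powi_pos[of "m + k"] ennreal_mult[of "3 / 2" "real q powi (m + k)"]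
    by (simp add: mult.assoc)
qed

text \<open>The chosen \<open>g\<close> is known only as a limit of Fourier integrals. All three
  facts are relations between energies over Borel sets, and these pass to the limit by
  \<open>energy_tendsto\<close>.\<close>

lemma plancherel_transform:
  assumes f: "square_integrable \<mu> f"
  defines "g \<equiv> plancherel_transform \<mu> \<psi> f"
  shows square_integrable_plancherel: "square_integrable \<mu> g"
    and energy_plancherel: "energy \<mu> UNIV g = energy \<mu> UNIV f"
    and plancherel_concentration: "energy \<mu> (disc b k) g
      \<le> ennreal (3 / 2 * real q powi (m + k)) * energy \<mu> UNIV f + 3 * energy \<mu> (- disc a m) f"
proof -
  obtain h where g: "square_integrable \<mu> g"
    and h1: "\<And>n. integrable \<mu> (h n)" and h2: "\<And>n. square_integrable \<mu> (h n)"
    and hf: "l2_tendsto \<mu> h f" and hg: "l2_tendsto \<mu> (\<lambda>n. fourier_integral \<mu> \<psi> (h n)) g"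
    using someI_ex[OF plancherel_transform_exists[OF f]]
    unfolding g_def plancherel_transform_def by blast
  have F: "square_integrable \<mu> (fourier_integral \<mu> \<psi> (h n))" for n
    by (rule square_integrable_fourier_integral[OF h1 h2])
  have limf: "(\<lambda>n. energy \<mu> S (h n)) \<longlonglongrightarrow> energy \<mu> S f" if "S \<in> sets borel" for S
    using that by (intro energy_tendsto h2 f hf) simp
  have limg: "(\<lambda>n. energy \<mu> S (fourier_integral \<mu> \<psi> (h n))) \<longlonglongrightarrow> energy \<mu> S g" if "S \<in> sets borel" for S
    using that by (intro energy_tendsto F g hg) simp
  show "square_integrable \<mu> g" by fact
  show "energy \<mu> UNIV g = energy \<mu> UNIV f"
    using limg[of UNIV] limf[of UNIV] unfolding energy_fourier_integral[OF h1 h2]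
    by (intro LIMSEQ_unique) simp_all
  show "energy \<mu> (disc b k) g
      \<le> ennreal (3 / 2 * real q powi (m + k)) * energy \<mu> UNIV f + 3 * energy \<mu> (- disc a m) f"
  proof (rule LIMSEQ_le)
    show "(\<lambda>n. energy \<mu> (disc b k) (fourier_integral \<mu> \<psi> (h n))) \<longlonglongrightarrow> energy \<mu> (disc b k) g"
      by (rule limg) measurable
    show "(\<lambda>n. ennreal (3 / 2 * real q powi (m + k)) * energy \<mu> UNIV (h n) + 3 * energy \<mu> (- disc a m) (h n))
      \<longlonglongrightarrow> ennreal (3 / 2 * real q powi (m + k)) * energy \<mu> UNIV f + 3 * energy \<mu> (- disc a m) f"
      by (intro tendsto_add ennreal_tendsto_cmult limf) simp_all
  qed (use fourier_concentration[OF h1 h2] in blast)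
qed

text \<open>Chebyshev's inequality, with threshold \<open>q powi (m + 1)\<close> instead of the
  radius thanks to \<open>not_in_disc\<close>.\<close>

lemma energy_outside_disc_le:
  assumes [measurable]: "u \<in> borel_measurable borel"
  shows "ennreal ((real q powi (m + 1))\<^sup>2) * energy \<mu> (- disc a m) u
    \<le> (\<integral>\<^sup>+x. ennreal ((absv (x - a))\<^sup>2 * (norm (u x))\<^sup>2) \<partial>\<mu>)"
proof -
  have "ennreal ((real q powi (m + 1))\<^sup>2) * energy \<mu> (- disc a m) u
      = (\<integral>\<^sup>+x. ennreal ((real q powi (m + 1))\<^sup>2) * (ennreal ((norm (u x))\<^sup>2) * indicator (- disc a m) x) \<partial>\<mu>)"
    unfolding energy_def by (rule nn_integral_cmult[symmetric]) measurable
  also have "\<dots> \<le> (\<integral>\<^sup>+x. ennreal ((absv (x - a))\<^sup>2 * (norm (u x))\<^sup>2) \<partial>\<mu>)"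
  proof (rule nn_integral_mono)
    fix x
    show "ennreal ((real q powi (m + 1))\<^sup>2) * (ennreal ((norm (u x))\<^sup>2) * indicator (- disc a m) x)
        \<le> ennreal ((absv (x - a))\<^sup>2 * (norm (u x))\<^sup>2)"
    proof (cases "x \<in> disc a m")
      case False
      have "(real q powi (m + 1))\<^sup>2 \<le> (absv (x - a))\<^sup>2"
        using not_in_disc[OF False] q_powi_pos[of "m + 1"] by (intro power_mono) simp_all
      then have "(real q powi (m + 1))\<^sup>2 * (norm (u x))\<^sup>2 \<le> (absv (x - a))\<^sup>2 * (norm (u x))\<^sup>2"
        by (rule mult_right_mono) simp
      then show ?thesis
        using False by (simp add: ennreal_mult[symmetric] ennreal_leI)
    qed simp
  qed
  finally show ?thesis .
qed

text \<open>The weight vanishes only on a null set. For nonzero \<open>f\<close> this excludes the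
  product of 0 and infinity, which is 0 in \<open>ennreal\<close>, and makes the moment positive so
  that a logarithm can select the radius.\<close>

lemma moment_eq_0_imp_energy_eq_0:
  assumes [measurable]: "u \<in> borel_measurable borel"
    and "(\<integral>\<^sup>+x. ennreal ((absv (x - a))\<^sup>2 * (norm (u x))\<^sup>2) \<partial>\<mu>) = 0"
  shows "energy \<mu> UNIV u = 0"
proof -
  have "AE x in \<mu>. ennreal ((absv (x - a))\<^sup>2 * (norm (u x))\<^sup>2) = 0"
    using assms(2) by (subst (asm) nn_integral_0_iff_AE) simp_all
  moreover have "{a} \<in> null_sets \<mu>"
    using emeasure_singleton[of a] by (intro null_setsI) simp_all
  then have "AE x in \<mu>. x \<noteq> a"
    using AE_not_in by fastforce
  ultimately have "AE x in \<mu>. ennreal ((norm (u x))\<^sup>2) = 0"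
  proof eventually_elim
    case (elim x)
    have "absv (x - a) \<noteq> 0"
      using elim(2) by (simp add: absv_eq_0_iff)
    moreover have "(absv (x - a))\<^sup>2 * (norm (u x))\<^sup>2 = 0"
      using elim(1) by (simp only: ennreal_eq_0_iff) (rule antisym, simp_all)
    ultimately show ?case by simp
  qed
  then show ?thesis
    unfolding energy_def by (subst nn_integral_0_iff_AE) auto
qed

text \<open>The exponent is the integer part of the logarithm of \<open>sqrt y\<close> to base
  \<open>q\<close>. The upper bound will make the tail of \<open>f\<close> small; the lower bound
  will turn the radius into a lower bound for the moment.\<close>

lemma ex_powi_power2_bracket:
  assumes "0 < y"
  obtains m where "(real q powi m)\<^sup>2 \<le> y" "y < (real q powi (m + 1))\<^sup>2"
proof
  let ?m = "\<lfloor>log (real q) (sqrt y)\<rfloor>"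
  have eq: "real q powi k = real q powr real_of_int k" for k
    using q_pos by (simp add: powr_real_of_int')
  have s: "real q powr (log (real q) (sqrt y)) = sqrt y"
    using q_gt_1 assms by (simp add: powr_log_cancel)
  have "real q powr real_of_int ?m \<le> real q powr (log (real q) (sqrt y))"
    using q_gt_1 by (intro powr_mono) auto
  then have "(real q powi ?m)\<^sup>2 \<le> (sqrt y)\<^sup>2"
    unfolding s eq by (intro power_mono) simp_all
  then show "(real q powi ?m)\<^sup>2 \<le> y"
    using assms by simp
  have "real q powr (log (real q) (sqrt y)) < real q powr real_of_int (?m + 1)"
    using q_gt_1 by (intro powr_less_mono floor_correct[THEN conjunct2]) simp
  then have "(sqrt y)\<^sup>2 < (real q powi (?m + 1))\<^sup>2"
    unfolding s eq using assms by (intro power_strict_mono) simp_all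
  then show "y < (real q powi (?m + 1))\<^sup>2"
    using assms by simp
qed

theorem uncertainty_principle:
  assumes f: "square_integrable \<mu> f"
  defines "N \<equiv> (\<integral>x. (norm (f x))\<^sup>2 \<partial>\<mu>)"
  shows "ennreal (N\<^sup>2 / 192) \<le> (\<integral>\<^sup>+x. ennreal ((absv (x - a))\<^sup>2 * (norm (f x))\<^sup>2) \<partial>\<mu>) *
     (\<integral>\<^sup>+\<xi>. ennreal ((absv (\<xi> - b))\<^sup>2 * (norm (plancherel_transform \<mu> \<psi> f \<xi>))\<^sup>2) \<partial>\<mu>)" (is "_ \<le> ?V * ?W")
proof -
  define g where "g = plancherel_transform \<mu> \<psi> f"
  have g: "square_integrable \<mu> g"
    unfolding g_def by (rule square_integrable_plancherel[OF f])
  have [measurable]: "f \<in> borel_measurable borel" "g \<in> borel_measurable borel"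
    by (rule square_integrable_measurable[OF f] square_integrable_measurable[OF g])+
  have "0 \<le> N"
    by (simp add: N_def)
  have EN: "energy \<mu> UNIV f = ennreal N"
    using energy_eq_integral(1)[OF f, of UNIV] by (simp add: N_def)
  have ENg: "energy \<mu> UNIV g = ennreal N"
    using energy_plancherel[OF f] EN by (simp add: g_def)
  consider "N = 0" | "0 < N" "?V = \<infinity> \<or> ?W = \<infinity>" | "0 < N" "?V \<noteq> \<infinity>" "?W \<noteq> \<infinity>"
    using \<open>0 \<le> N\<close> less_eq_real_def[of 0 N] by blast
  then show ?thesis
  proof cases
    case 2
    have "?V \<noteq> 0" "?W \<noteq> 0"
      using moment_eq_0_imp_energy_eq_0[of f a] moment_eq_0_imp_energy_eq_0[of g b] EN ENg \<open>0 < N\<close>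
        \<open>g \<in> borel_measurable borel\<close>
      by (auto simp: g_def)
    then have "?V * ?W = \<infinity>"
      using 2 by (auto simp: ennreal_mult_eq_top_iff)
    then show ?thesis by simp
  next
    case 3
    obtain V where V: "?V = ennreal V" "0 \<le> V"
      using 3 by (cases ?V) auto
    obtain W where W: "?W = ennreal W" "0 \<le> W"
      using 3 by (cases ?W) auto
    have "V \<noteq> 0"
      using moment_eq_0_imp_energy_eq_0[of f a] EN \<open>0 < N\<close> V by auto
    \<comment> \<open>With 24 = 3 * 8 the Chebyshev tail is at most \<open>N / 24\<close>, and after
      the weight 3 in \<open>plancherel_concentration\<close> it costs \<open>N / 8\<close>.\<close>
    then have "0 < 24 * V / N"
      using V \<open>0 < N\<close> by simp
    then obtain m where m: "(real q powi m)\<^sup>2 \<le> 24 * V / N" "24 * V / N < (real q powi (m + 1))\<^sup>2"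
      by (rule ex_powi_power2_bracket)
    \<comment> \<open>The largest exponent for which the product of the radii is at most
      \<open>1 / q\<close>. The next value after this radius is \<open>1 / r\<close>, the reciprocal
      of the other radius.\<close>
    define k where "k = - 1 - m"
    define r where "r = real q powi m"
    have "0 < r"
      unfolding r_def by (rule q_powi_pos)
    have q_mk: "real q powi (m + k) = 1 / real q" and q_k: "real q powi (k + 1) = 1 / r"
      using q_neq_0 by (simp_all add: k_def r_def power_int_minus divide_inverse)
    obtain Tf where Tf: "energy \<mu> (- disc a m) f = ennreal Tf" "0 \<le> Tf"
      using energy_eq_integral(1)[OF f, of "- disc a m"] by auto
    obtain Tg where Tg: "energy \<mu> (- disc b k) g = ennreal Tg" "0 \<le> Tg"
      using energy_eq_integral(1)[OF g, of "- disc b k"] by auto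
    obtain Bg where Bg: "energy \<mu> (disc b k) g = ennreal Bg" "0 \<le> Bg"
      using energy_eq_integral(1)[OF g, of "disc b k"] by auto
    have split: "N = Bg + Tg"
      using energy_split[of g \<mu> "disc b k"] ENg Tg Bg \<open>0 \<le> N\<close>
      by (simp add: ennreal_plus[symmetric] del: ennreal_plus)
    have 1: "(real q powi (m + 1))\<^sup>2 * Tf \<le> V"
      using energy_outside_disc_le[of f m a] V Tf by (simp add: ennreal_mult[symmetric])
    have 2: "(1 / r)\<^sup>2 * Tg \<le> W"
      using energy_outside_disc_le[of g k b] W Tg \<open>0 < r\<close>
      by (simp add: q_k g_def[symmetric] ennreal_mult[symmetric])
    have "energy \<mu> (disc b k) g \<le> ennreal (3 / 2 * real q powi (m + k)) * ennreal N + 3 * ennreal Tf"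
      using plancherel_concentration[OF f, of b k m a] by (simp add: g_def EN Tf)
    also have "\<dots> = ennreal (3 / 2 * (1 / real q) * N + 3 * Tf)"
      unfolding q_mk using q_pos \<open>0 \<le> N\<close> Tf(2)
      by (subst ennreal_plus, simp_all add: ennreal_mult'[symmetric] ennreal_mult)
    finally have "Bg \<le> 3 / 2 * (1 / real q) * N + 3 * Tf"
      unfolding Bg(1) using q_pos \<open>0 \<le> N\<close> Tf(2) by (subst (asm) ennreal_le_iff) simp_all
    moreover have "3 / 2 * (1 / real q) * N \<le> 3 / 4 * N"
      using q_ge_2 \<open>0 < N\<close> by (intro mult_right_mono) (simp_all add: field_simps)
    moreover have "3 * Tf \<le> N / 8"
    proof -
      have "24 * V < N * (real q powi (m + 1))\<^sup>2"
        using m(2) \<open>0 < N\<close> by (simp add: field_simps)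
      then have "(real q powi (m + 1))\<^sup>2 * (24 * Tf) \<le> (real q powi (m + 1))\<^sup>2 * N"
        using 1 by (simp add: mult.commute)
      then have "24 * Tf \<le> N"
        by (rule mult_left_le_imp_le) (intro zero_less_power q_powi_pos)
      then show ?thesis by simp
    qed
    \<comment> \<open>The mass inside the disc is at most \<open>3 / 4 + 1 / 8\<close> of the total,
      so an eighth is left outside.\<close>
    ultimately have "N / 8 \<le> Tg"
      using split by linarith
    then have "(1 / r)\<^sup>2 * (N / 8) \<le> W"
      using 2 mult_left_mono[of "N / 8" Tg "(1 / r)\<^sup>2"] by simp
    moreover have "r\<^sup>2 * N / 24 \<le> V"
      using m(1) \<open>0 < N\<close> by (simp add: r_def[symmetric] field_simps)
    ultimately have "(r\<^sup>2 * N / 24) * ((1 / r)\<^sup>2 * (N / 8)) \<le> V * W"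
      using V(2) \<open>0 < N\<close> by (intro mult_mono) simp_all
    also have "(r\<^sup>2 * N / 24) * ((1 / r)\<^sup>2 * (N / 8)) = N\<^sup>2 / 192"
      using \<open>0 < r\<close> by (simp add: power2_eq_square)
    finally show ?thesis
      using V W by (simp add: ennreal_mult[symmetric] ennreal_leI)
  qed simp
qed


end

section \<open>The constant \<open>alpha1\<close> and the conclusion\<close>

lemma alpha1_le: "alpha1 \<le> 1 / 256"
proof -
  define p :: "real \<Rightarrow> real" where "p \<delta> = (1 - 2 * \<delta>) ^ 4 * (2 * \<delta> - \<delta>\<^sup>2) ^ 4" for \<delta>
  \<comment> \<open>\<open>GREATEST\<close> is meaningful only if the maximum is attained. It is
    attained on the closed interval by compactness, and the endpoints are excluded because
    \<open>p\<close> vanishes there and is positive at \<open>1 / 4\<close>.\<close>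
  have "continuous_on {0..1/2} p"
    unfolding p_def by (intro continuous_intros)
  then obtain d where d: "d \<in> {0..1/2}" "\<And>\<delta>. \<delta> \<in> {0..1/2} \<Longrightarrow> p \<delta> \<le> p d"
    using continuous_attains_sup[of "{0..1/2}" p] by auto
  have "0 < p (1 / 4)"
    by (simp add: p_def power2_eq_square)
  then have "0 < p d"
    using d(2)[of "1 / 4"] by simp
  moreover have "p 0 = 0" "p (1 / 2) = 0"
    by (simp_all add: p_def)
  ultimately have "d \<noteq> 0" "d \<noteq> 1 / 2"
    by (metis less_irrefl)+
  then have d': "d \<in> {0<..<1/2}"
    using d(1) by auto
  have "alpha1 = p d"
    unfolding alpha1_def
  proof (rule Greatest_equality)
    show "\<exists>\<delta>\<in>{0<..<1/2}. p d = (1 - 2 * \<delta>) ^ 4 * (2 * \<delta> - \<delta>\<^sup>2) ^ 4"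
      using d' unfolding p_def by blast
    fix y :: real
    assume "\<exists>\<delta>\<in>{0<..<1/2}. y = (1 - 2 * \<delta>) ^ 4 * (2 * \<delta> - \<delta>\<^sup>2) ^ 4"
    then show "y \<le> p d"
      using d(2) by (auto simp: p_def)
  qed
  also have "p d \<le> (1 / 4) ^ 4"
  proof -
    have "0 \<le> d * (2 - d)"
      using d' by (intro mult_nonneg_nonneg) auto
    then have nn: "0 \<le> 2 * d - d\<^sup>2"
      by (simp add: power2_eq_square algebra_simps)
    \<comment> \<open>Dropping the square leaves \<open>s * (1 - s)\<close> with
      \<open>s = 2 * d\<close>, which is at most \<open>1 / 4\<close>; the fourth power of this
      bound is \<open>1 / 256\<close>.\<close>
    have "(1 - 2 * d) * (2 * d - d\<^sup>2) \<le> (1 - 2 * d) * (2 * d)"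
      using d' by (intro mult_left_mono) auto
    also have "\<dots> \<le> 1 / 4"
      using zero_le_power2[of "2 * d - 1 / 2"] by (simp add: power2_eq_square algebra_simps)
    finally have "((1 - 2 * d) * (2 * d - d\<^sup>2)) ^ 4 \<le> (1 / 4) ^ 4"
      using d' nn by (intro power_mono mult_nonneg_nonneg) auto
    then show ?thesis
      by (simp add: p_def power_mult_distrib)
  qed
  finally show ?thesis
    by (simp add: power_one_over)
qed

theorem mainTheorem5:
  fixes absv :: "'a::td_local_field \<Rightarrow> real"
    and q :: nat
    and \<mu> :: "'a measure"
    and \<psi> :: "'a \<Rightarrow> complex"
    and f :: "'a \<Rightarrow> complex"
  assumes "local_field_data absv q \<mu> \<psi>"
    and "square_integrable \<mu> f"
  shows "(INF (a, b)\<in>UNIV.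
            (\<integral>\<^sup>+x. ennreal ((absv (x - a))\<^sup>2 * (norm (f x))\<^sup>2) \<partial>\<mu>) *
            (\<integral>\<^sup>+\<xi>. ennreal ((absv (\<xi> - b))\<^sup>2 * (norm (plancherel_transform \<mu> \<psi> f \<xi>))\<^sup>2) \<partial>\<mu>))
         \<ge> ennreal (alpha1 * l2_norm \<mu> f ^ 4)"
proof (rule INF_greatest)
  interpret local_field_data absv q \<mu> \<psi> by fact
  define N where "N = (\<integral>x. (norm (f x))\<^sup>2 \<partial>\<mu>)"
  have "0 \<le> N"
    by (simp add: N_def)
  have "l2_norm \<mu> f ^ 4 = ((sqrt N)\<^sup>2)\<^sup>2"
    unfolding l2_norm_def N_def power_mult[symmetric] by simp
  also have "\<dots> = N\<^sup>2"
    using \<open>0 \<le> N\<close> by simp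
  finally have "l2_norm \<mu> f ^ 4 = N\<^sup>2" .
  \<comment> \<open>The bound \<open>1 / 256\<close> on \<open>alpha1\<close> lies below the
    constant \<open>1 / 192\<close> of \<open>uncertainty_principle\<close>.\<close>
  moreover have "alpha1 * N\<^sup>2 \<le> 1 / 192 * N\<^sup>2"
    using alpha1_le by (intro mult_right_mono) simp_all
  ultimately have le: "ennreal (alpha1 * l2_norm \<mu> f ^ 4) \<le> ennreal (N\<^sup>2 / 192)"
    by (intro ennreal_leI) simp
  fix ab :: "'a \<times> 'a"
  obtain a b where ab: "ab = (a, b)" by fastforce
  show "ennreal (alpha1 * l2_norm \<mu> f ^ 4) \<le> (case ab of (a, b) \<Rightarrow>
            (\<integral>\<^sup>+x. ennreal ((absv (x - a))\<^sup>2 * (norm (f x))\<^sup>2) \<partial>\<mu>) *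
            (\<integral>\<^sup>+\<xi>. ennreal ((absv (\<xi> - b))\<^sup>2 * (norm (plancherel_transform \<mu> \<psi> f \<xi>))\<^sup>2) \<partial>\<mu>))"
    unfolding ab prod.case using le uncertainty_principle[OF assms(2)] unfolding N_def
    by (rule order_trans)
qed

end
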